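(* Let $\Omega=[0,1]$, $g\in L^2(\Omega)$, and let $K:\Omega^2\to\mathbb{R}$ be nonnegative, measurable, symmetric and bounded. Let $\lambda>0$, and let $u^\star$ and $u_n^\star$ be the unique minimizers of $E_\lambda(\cdot,g,K)$ over $L^2(\Omega)$ and of $E_{n,\lambda}(\cdot,g_n,K_n)$ over $\mathbb{R}^n$, respectively, for the exponent $p$. (i) If $p\in[1,2]$, then $$\|I_nu_n^\star-u^\star\|_{L^2(\Omega)}^2\le C\Big(\|g-I_ng_n\|_{L^2(\Omega)}^2+\|g-I_ng_n\|_{L^2(\Omega)}+\lambda\|K-I_nK_n\|_{L^{\frac{2}{2-p}}(\Omega^2)}+\lambda\|u^\star-I_nP_nu^\star\|_{L^{\frac{2}{3-p}}(\Omega)}\Big),$$ where $C$ is a positive constant independent of $n$ and $\lambda$. (ii) If $\inf_{(x,y)\in\Omega^2}K(x,y)\ge\kappa>0$, then for any $p\in[1,+\infty[$, $$\|I_nu_n^\star-u^\star\|_{L^2(\Omega)}^2\le C\Big(\|g-I_ng_n\|_{L^2(\Omega)}^2+\|g-I_ng_n\|_{L^2(\Omega)}+\|K-I_nK_n\|_{L^{\infty}(\Omega^2)}+\lambda^{1/p}\|u^\star-I_nP_nu^\star\|_{L^{p}(\Omega)}\Big),$$ where $C$ is a positive constant independent of $n$.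
   Context: $\Omega=[0,1]$; by convention $\frac{2}{2-p}=+\infty$ when $p=2$. For $u\in L^2(\Omega)$, $$\mathcal{R}_p(u,K)=\frac{1}{2p}\int_{\Omega^2}K(x,y)|u(y)-u(x)|^p\,dx\,dy$$ if this integral is finite and $+\infty$ otherwise, and $E_\lambda(u,g,K)=\frac{1}{2\lambda}\|u-g\|_{L^2(\Omega)}^2+\mathcal{R}_p(u,K)$. For $n\in\mathbb{N}^*$ let $\Omega_i^{(n)}=[\frac{i-1}{n},\frac{i}{n}[$, $i=1,\dots,n$, and $\Omega_{ij}^{(n)}=\Omega_i^{(n)}\times\Omega_j^{(n)}$. Projector: $(P_nv)_i=n\int_{\Omega_i^{(n)}}v(x)\,dx$ for $v\in L^1(\Omega)$, and $(P_nF)_{ij}=n^2\int_{\Omega_{ij}^{(n)}}F(x,y)\,dx\,dy$ for $F\in L^1(\Omega^2)$. Set $g_n=P_ng\in\mathbb{R}^n$ and $K_n=P_nK\in\mathbb{R}^{n\times n}$. Injector: $I_nv_n(x)=\sum_{i=1}^nv_{ni}\mathbf{1}_{\Omega_i^{(n)}}(x)$ for $v_n\in\mathbb{R}^n$, and $I_nK_n(x,y)=\sum_{i,j=1}^nK_{nij}\mathbf{1}_{\Omega_{ij}^{(n)}}(x,y)$ ($\mathbf{1}_A$ equals $1$ on $A$ and $0$ elsewhere). Discrete functional: for $u_n\in\mathbb{R}^n$, $$E_{n,\lambda}(u_n,g_n,K_n)=\frac{1}{2\lambda n}\sum_{i=1}^n|u_{ni}-g_{ni}|^2+\frac{1}{2n^2p}\sum_{i,j=1}^nK_{nij}|u_{nj}-u_{ni}|^p.$$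 Both minimizers exist and are unique. The constants $C$ may depend on $p$, $g$, $K$ (and, in (ii), also on $\kappa$ and $\lambda$). *)

theory Defs
  imports "HOL-Analysis.Analysis" "HOL-Probability.Essential_Supremum"
begin

abbreviation Omega :: "real set" where
  "Omega \<equiv> {0..1}"

(* The L^q norm with values in [0,\<infinity>]; a measurable function outside L^q has norm \<infinity>.
   The exponent is an extended real q \<ge> 1, so that the convention 2 / (2 - p) = \<infinity> for
   p = 2 is ordinary division 2 / 0 in ennreal. *)
definition Lnorm :: "'a measure \<Rightarrow> ennreal \<Rightarrow> ('a \<Rightarrow> real) \<Rightarrow> ennreal" where
  "Lnorm M q f =
     (if q = \<infinity> then esssup M (\<lambda>x. ennreal \<bar>f x\<bar>)
      else let r = enn2real q; I = (\<integral>\<^sup>+ x. ennreal (\<bar>f x\<bar> powr r) \<partial>M)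
           in if I = \<infinity> then \<infinity> else ennreal (enn2real I powr (1 / r)))"

definition L2 :: "(real \<Rightarrow> real) set" where
  "L2 = {u \<in> borel_measurable (lebesgue_on Omega). Lnorm (lebesgue_on Omega) 2 u < \<infinity>}"

(* Ordinary functions stand for their a.e. classes. The real integral is passed to ennreal,
   which loses nothing because kernels are nonnegative throughout. *)
definition regularizer :: "real \<Rightarrow> (real \<Rightarrow> real) \<Rightarrow> (real \<times> real \<Rightarrow> real) \<Rightarrow> ennreal" where
  "regularizer p u K =
     (if integrable (lebesgue_on (Omega \<times> Omega)) (\<lambda>(x, y). K (x, y) * \<bar>u y - u x\<bar> powr p)
      then ennreal (1 / (2 * p) *
             (LINT (x, y) | lebesgue_on (Omega \<times> Omega). K (x, y) * \<bar>u y - u x\<bar> powr p))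
      else \<infinity>)"

definition energy ::
  "real \<Rightarrow> real \<Rightarrow> (real \<Rightarrow> real) \<Rightarrow> (real \<Rightarrow> real) \<Rightarrow> (real \<times> real \<Rightarrow> real) \<Rightarrow> ennreal" where
  "energy p lam u g K =
     ennreal (1 / (2 * lam)) * (Lnorm (lebesgue_on Omega) 2 (\<lambda>x. u x - g x))\<^sup>2
     + regularizer p u K"

definition cell :: "nat \<Rightarrow> nat \<Rightarrow> real set" where
  "cell n i = {(real i - 1) / real n ..< real i / real n}"

(* Vectors in R^n and n x n matrices are functions on nat and nat x nat of which only the
   entries with indices in {1..n} are ever used; in particular the discrete energy below
   depends on these entries only. *)
definition proj1 :: "nat \<Rightarrow> (real \<Rightarrow> real) \<Rightarrow> nat \<Rightarrow> real" where
  "proj1 n v i = real n * (LINT x : cell n i | lebesgue. v x)"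

definition proj2 :: "nat \<Rightarrow> (real \<times> real \<Rightarrow> real) \<Rightarrow> nat \<Rightarrow> nat \<Rightarrow> real" where
  "proj2 n F i j = (real n)\<^sup>2 * (LINT z : cell n i \<times> cell n j | lebesgue. F z)"

definition inj1 :: "nat \<Rightarrow> (nat \<Rightarrow> real) \<Rightarrow> real \<Rightarrow> real" where
  "inj1 n v x = (\<Sum>i=1..n. v i * indicator (cell n i) x)"

definition inj2 :: "nat \<Rightarrow> (nat \<Rightarrow> nat \<Rightarrow> real) \<Rightarrow> real \<times> real \<Rightarrow> real" where
  "inj2 n F z = (\<Sum>i=1..n. \<Sum>j=1..n. F i j * indicator (cell n i \<times> cell n j) z)"

definition discrete_energy ::
  "real \<Rightarrow> nat \<Rightarrow> real \<Rightarrow> (nat \<Rightarrow> real) \<Rightarrow> (nat \<Rightarrow> real) \<Rightarrow> (nat \<Rightarrow> nat \<Rightarrow> real) \<Rightarrow> real" where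
  "discrete_energy p n lam u g K =
     1 / (2 * lam * real n) * (\<Sum>i=1..n. \<bar>u i - g i\<bar>\<^sup>2)
     + 1 / (2 * (real n)\<^sup>2 * p) * (\<Sum>i=1..n. \<Sum>j=1..n. K i j * \<bar>u j - u i\<bar> powr p)"

definition minimizer ::
  "real \<Rightarrow> real \<Rightarrow> (real \<Rightarrow> real) \<Rightarrow> (real \<times> real \<Rightarrow> real) \<Rightarrow> (real \<Rightarrow> real) \<Rightarrow> bool" where
  "minimizer p lam g K u \<longleftrightarrow> is_arg_min (\<lambda>v. energy p lam v g K) (\<lambda>v. v \<in> L2) u"

definition discrete_minimizer ::
  "real \<Rightarrow> nat \<Rightarrow> real \<Rightarrow> (real \<Rightarrow> real) \<Rightarrow> (real \<times> real \<Rightarrow> real) \<Rightarrow> (nat \<Rightarrow> real) \<Rightarrow> bool" where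
  "discrete_minimizer p n lam g K u \<longleftrightarrow>
     is_arg_min (\<lambda>v. discrete_energy p n lam v (proj1 n g) (proj2 n K)) (\<lambda>v. True) u"

end

theory Submission
  imports Defs "HOL-Probability.Probability_Measure"
begin

text \<open>Since \<open>K_n\<close> consists of cell averages, the discrete energy of \<open>v\<close> equals, up to an additive constant,
  the continuous energy of \<open>I_n v\<close>, so \<open>I_n u_n\<close> minimises the continuous energy over the functions
  constant on the cells. By strong convexity \<open>\<parallel>I_n u_n - u\<parallel>\<^sup>2\<close> is bounded by \<open>2\<lambda>\<close> times the energy
  excess of \<open>I_n u_n\<close>, hence by that of \<open>I_n P_n u\<close>. Orthogonality bounds the fidelity part of the latter
  by \<open>\<parallel>g - I_n P_n g\<parallel>\<^sup>2\<close>, and Jensen's inequality on the cells bounds the regularity part by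
  \<open>1 / (2 p)\<close> times the integral of \<open>\<bar>K - I_n K_n\<bar> \<bar>u y - u x\<bar>\<^sup>p\<close>, to which Hoelder's inequality and the a priori
  bounds on \<open>u\<close> apply. The two remaining terms of the estimate are only slack.\<close>

section \<open>Lebesgue measure on the unit interval and the unit square\<close>

text \<open>Two points shape the argument. The integrals on the square use the completed Lebesgue
  measure, not the product of two completed measures, and K is measurable only for the former; so K
  is never integrated in one variable at a time, and Fubini serves only for functions of a single
  coordinate. Secondly, Jensen's inequality on a product of cells calls for a weight that is
  constant there. That weight is \<open>inj2 n (proj2 n K)\<close>, and exchanging it for K is the
  sole source of the kernel error. The exponent 2/(2-p) is conjugate to 2/p, the power that turns
  p-th powers of increments of u into squares, which the L2 norm of u controls. If K is bounded
  below by a positive number, the regularizer itself controls the p-th powers, and the supremum norm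
  of the kernel error suffices for every p. Comparison of the minimizer with the zero function
  bounds its squared norm by 4 times that of g, and lambda/p times the weighted integral by that of
  g; these two bounds produce the constants \<open>1 + 16 * sqnorm g\<close> and
  \<open>1 + sqnorm g / \<kappa>\<close>.\<close>

abbreviation LI :: "real measure" where "LI \<equiv> lebesgue_on Omega"
abbreviation LS :: "(real \<times> real) measure" where "LS \<equiv> lebesgue_on (Omega \<times> Omega)"

text \<open>Up to subsets of Borel null sets, S and T are Borel sets \<open>S1\<close> and
  \<open>T1\<close>. The two rectangles then differ only inside two strips over null sets, and the
  Borel rectangle obeys the product formula.\<close>

lemma lebesgue_Times:
  fixes S :: "'a::euclidean_space set" and T :: "'b::euclidean_space set"
  assumes S: "S \<in> sets lebesgue" and T: "T \<in> sets lebesgue"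
  shows "S \<times> T \<in> sets lebesgue"
    and "emeasure lebesgue (S \<times> T) = emeasure lebesgue S * emeasure lebesgue T"
proof -
  obtain S1 S0 N1 where S1: "S = S1 \<union> S0" "S0 \<subseteq> N1" "N1 \<in> null_sets lborel" "S1 \<in> sets lborel"
    using S by (rule sets_completionE) auto
  obtain T1 T0 N2 where T1: "T = T1 \<union> T0" "T0 \<subseteq> N2" "N2 \<in> null_sets lborel" "T1 \<in> sets lborel"
    using T by (rule sets_completionE) auto
  have borel_UNIV: "UNIV \<in> sets (borel :: 'c::topological_space measure)" by simp
  have N1: "N1 \<in> sets borel" and N2: "N2 \<in> sets borel"
    and [measurable]: "S1 \<in> sets borel" "T1 \<in> sets borel"
    using S1 T1 by auto
  have emb: "emeasure lborel (A \<times> B) = emeasure lborel A * emeasure lborel B"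
    if "A \<in> sets borel" "B \<in> sets borel" for A :: "'a set" and B :: "'b set"
    using that by (simp add: lborel_prod[symmetric] lborel.emeasure_pair_measure_Times)
  let ?Z = "N1 \<times> UNIV \<union> UNIV \<times> N2"
  have prod_sets: "A \<times> B \<in> sets borel" if "A \<in> sets borel" "B \<in> sets borel"
    for A :: "'a set" and B :: "'b set"
    using that by (simp add: borel_prod[symmetric])
  \<comment> \<open>Each strip has measure 0 times infinity, which is 0 in
    \<open>ennreal\<close>.\<close>
  have Z: "?Z \<in> null_sets lborel"
  proof (rule null_sets.Un)
    show "N1 \<times> (UNIV :: 'b set) \<in> null_sets lborel" "(UNIV :: 'a set) \<times> N2 \<in> null_sets lborel"
      using S1(3) T1(3) emb[OF N1 borel_UNIV] emb[OF borel_UNIV N2]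
        prod_sets[OF N1 borel_UNIV] prod_sets[OF borel_UNIV N2]
      by (simp_all add: null_sets_def)
  qed
  have eq: "S \<times> T = (S1 \<times> T1) \<union> (S \<times> T - S1 \<times> T1)"
    using S1 T1 by auto
  have sub: "S \<times> T - S1 \<times> T1 \<subseteq> ?Z"
    using S1 T1 by auto
  have null: "S \<times> T - S1 \<times> T1 \<in> null_sets lebesgue"
    using Z sub by (meson completion.complete2 null_sets_completionI)
  have R: "S1 \<times> T1 \<in> sets lebesgue" by (simp add: prod_sets)
  show "S \<times> T \<in> sets lebesgue"
    by (subst eq) (rule sets.Un[OF R null_setsD2[OF null]])
  have "emeasure lebesgue (S \<times> T) = emeasure lebesgue (S1 \<times> T1)"
    by (subst eq) (rule emeasure_Un_null_set[OF R null])
  also have "\<dots> = emeasure lborel S1 * emeasure lborel T1"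
    by (simp add: emb prod_sets)
  also have "emeasure lborel S1 = emeasure lebesgue S"
  proof -
    have "S - S1 \<in> null_sets lebesgue"
      by (rule completion.complete2[of _ N1]) (use S1 in \<open>auto simp: null_sets_completionI\<close>)
    then have "emeasure lebesgue (S1 \<union> (S - S1)) = emeasure lebesgue S1"
      by (intro emeasure_Un_null_set) auto
    moreover have "S1 \<union> (S - S1) = S" using S1 by auto
    ultimately show ?thesis by simp
  qed
  also have "emeasure lborel T1 = emeasure lebesgue T"
  proof -
    have "T - T1 \<in> null_sets lebesgue"
      by (rule completion.complete2[of _ N2]) (use T1 in \<open>auto simp: null_sets_completionI\<close>)
    then have "emeasure lebesgue (T1 \<union> (T - T1)) = emeasure lebesgue T1"
      by (intro emeasure_Un_null_set) auto
    moreover have "T1 \<union> (T - T1) = T" using T1 by auto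
    ultimately show ?thesis by simp
  qed
  finally show "emeasure lebesgue (S \<times> T) = emeasure lebesgue S * emeasure lebesgue T" .
qed

lemma Omega_sets: "Omega \<in> sets lebesgue" "Omega \<times> Omega \<in> sets lebesgue"
  by (simp_all add: lebesgue_Times(1))

lemma sets_LI: "A \<in> sets LI \<longleftrightarrow> A \<subseteq> Omega \<and> A \<in> sets lebesgue"
  using Omega_sets by (auto simp: sets_restrict_space_iff)

lemma sets_LS: "A \<in> sets LS \<longleftrightarrow> A \<subseteq> Omega \<times> Omega \<and> A \<in> sets lebesgue"
  using Omega_sets by (auto simp: sets_restrict_space_iff)

interpretation LI: prob_space LI
  by standard (simp add: emeasure_restrict_space)

interpretation LS: prob_space LS
proof
  have "emeasure LS (space LS) = emeasure lebesgue (Omega \<times> Omega)"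
    using Omega_sets(2) by (subst emeasure_restrict_space) auto
  also have "\<dots> = emeasure lebesgue Omega * emeasure lebesgue Omega"
    by (rule lebesgue_Times(2)) simp_all
  finally show "emeasure LS (space LS) = 1" by simp
qed

interpretation LP: pair_prob_space LI LI ..

lemma Times_LS:
  assumes "A \<in> sets LI" "B \<in> sets LI"
  shows "A \<times> B \<in> sets LS" "emeasure LS (A \<times> B) = emeasure LI A * emeasure LI B"
proof -
  have AB: "A \<subseteq> Omega" "A \<in> sets lebesgue" "B \<subseteq> Omega" "B \<in> sets lebesgue"
    using assms by (auto simp only: sets_LI)
  show "A \<times> B \<in> sets LS"
    using AB by (auto simp: sets_LS lebesgue_Times(1))
  have "emeasure LS (A \<times> B) = emeasure lebesgue (A \<times> B)"
    using AB Omega_sets(2) by (intro emeasure_restrict_space) auto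
  moreover have "emeasure LI A = emeasure lebesgue A" "emeasure LI B = emeasure lebesgue B"
    by (rule emeasure_restrict_space; use AB Omega_sets(1) in simp)+
  ultimately show "emeasure LS (A \<times> B) = emeasure LI A * emeasure LI B"
    using lebesgue_Times(2)[OF AB(2,4)] by simp
qed

lemma id_measurable_LS: "(\<lambda>z. z) \<in> LS \<rightarrow>\<^sub>M LI \<Otimes>\<^sub>M LI"
proof (rule measurable_pair_measureI)
  show "(\<lambda>z. z) \<in> space LS \<rightarrow> space LI \<times> space LI" by auto
  fix A B assume AB: "A \<in> sets LI" "B \<in> sets LI"
  then have "(\<lambda>z. z) -` (A \<times> B) \<inter> space LS = A \<times> B"
    by (auto simp: sets_LI)
  then show "(\<lambda>z. z) -` (A \<times> B) \<inter> space LS \<in> sets LS"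
    using Times_LS(1)[OF AB] by simp
qed

text \<open>Both measures agree on rectangles, which determines them. This links the completed
  measure on the square to the product measure, where Fubini is available.\<close>

lemma distr_LS: "distr LS (LI \<Otimes>\<^sub>M LI) (\<lambda>z. z) = LI \<Otimes>\<^sub>M LI"
proof (rule pair_measure_eqI[symmetric])
  fix A B assume AB: "A \<in> sets LI" "B \<in> sets LI"
  then have eq: "(\<lambda>z. z) -` (A \<times> B) \<inter> space LS = A \<times> B"
    by (auto simp: sets_LI)
  show "emeasure LI A * emeasure LI B = emeasure (distr LS (LI \<Otimes>\<^sub>M LI) (\<lambda>z. z)) (A \<times> B)"
    using AB by (subst emeasure_distr[OF id_measurable_LS]) (simp_all only: eq Times_LS(2) pair_measureI)
qed (simp_all add: LI.sigma_finite_measure_axioms)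

lemma measurable_LS: "F \<in> LI \<Otimes>\<^sub>M LI \<rightarrow>\<^sub>M L \<Longrightarrow> F \<in> LS \<rightarrow>\<^sub>M L"
  by (rule measurable_compose[OF id_measurable_LS])

lemma integrable_LS:
  fixes F :: "real \<times> real \<Rightarrow> real"
  assumes "integrable (LI \<Otimes>\<^sub>M LI) F"
  shows "integrable LS F"
  using integrable_distr[OF id_measurable_LS, of F] assms by (simp add: distr_LS)

lemma integral_LS:
  fixes F :: "real \<times> real \<Rightarrow> real"
  assumes "F \<in> borel_measurable (LI \<Otimes>\<^sub>M LI)"
  shows "integral\<^sup>L LS F = integral\<^sup>L (LI \<Otimes>\<^sub>M LI) F"
  using integral_distr[OF id_measurable_LS assms] by (simp add: distr_LS)

lemma measurable_LS_fst:
  "f \<in> LI \<rightarrow>\<^sub>M L \<Longrightarrow> (\<lambda>z. f (fst z)) \<in> LS \<rightarrow>\<^sub>M L"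
  by (rule measurable_LS) (rule measurable_compose[OF measurable_fst])

lemma measurable_LS_snd:
  "f \<in> LI \<rightarrow>\<^sub>M L \<Longrightarrow> (\<lambda>z. f (snd z)) \<in> LS \<rightarrow>\<^sub>M L"
  by (rule measurable_LS) (rule measurable_compose[OF measurable_snd])

lemma integrable_LP:
  fixes f :: "real \<Rightarrow> real"
  assumes f: "integrable LI f"
  shows "integrable (LI \<Otimes>\<^sub>M LI) (\<lambda>z. f (fst z))"
    and "integrable (LI \<Otimes>\<^sub>M LI) (\<lambda>z. f (snd z))"
proof -
  have 1: "distr (LI \<Otimes>\<^sub>M LI) LI fst = LI"
    by (rule LI.distr_pair_fst) 
  show i1: "integrable (LI \<Otimes>\<^sub>M LI) (\<lambda>z. f (fst z))"
    using integrable_distr[of fst "LI \<Otimes>\<^sub>M LI" LI f] f by (simp add: 1)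
  show "integrable (LI \<Otimes>\<^sub>M LI) (\<lambda>z. f (snd z))"
    using LP.integrable_product_swap[OF i1] by (simp add: case_prod_beta')
qed

text \<open>The form in which Fubini is used below: one variable carries f, the other contributes
  only the length of its side.\<close>

lemma integral_rectangle:
  fixes f :: "real \<Rightarrow> real"
  assumes f: "integrable LI f" and A: "A \<in> sets LI" and B: "B \<in> sets LI"
  shows "integrable LS (\<lambda>z. f (fst z))"
    and "integrable LS (\<lambda>z. f (snd z))"
    and "(LINT z:A \<times> B|LS. f (fst z)) = measure LI B * (LINT x:A|LI. f x)"
    and "(LINT z:A \<times> B|LS. f (snd z)) = measure LI A * (LINT x:B|LI. f x)"
proof -
  show "integrable LS (\<lambda>z. f (fst z))" "integrable LS (\<lambda>z. f (snd z))"
    using integrable_LP[OF f] by (auto intro: integrable_LS)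
  have i1: "integrable (LI \<Otimes>\<^sub>M LI) (\<lambda>z. indicator (A \<times> B) z * f (fst z))"
    using integrable_real_mult_indicator[OF pair_measureI[OF A B] integrable_LP(1)[OF f]]
    by (subst mult.commute)
  have i2: "integrable (LI \<Otimes>\<^sub>M LI) (\<lambda>z. indicator (A \<times> B) z * f (snd z))"
    using integrable_real_mult_indicator[OF pair_measureI[OF A B] integrable_LP(2)[OF f]]
    by (subst mult.commute)
  have meas: "measure LI C = (LINT x|LI. indicator C x)" if "C \<in> sets LI" for C
    using sets.sets_into_space[OF that] by (simp only: Bochner_Integration.integral_indicator Int_absorb2)
  have "(LINT z:A \<times> B|LS. f (fst z)) = (LINT z|(LI \<Otimes>\<^sub>M LI). indicator (A \<times> B) z * f (fst z))"
    unfolding set_lebesgue_integral_def real_scaleR_def by (rule integral_LS) (rule borel_measurable_integrable[OF i1])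
  also have "\<dots> = (LINT x|LI. LINT y|LI. (indicator A x * f x) * indicator B y)"
    using LP.integral_fst'[OF i1]
    by (simp add: indicator_times algebra_simps)
  also have "\<dots> = measure LI B * (LINT x:A|LI. f x)"
    unfolding set_lebesgue_integral_def by (simp add: meas[OF B] mult.commute)
  finally show "(LINT z:A \<times> B|LS. f (fst z)) = measure LI B * (LINT x:A|LI. f x)" .
  have "(LINT z:A \<times> B|LS. f (snd z)) = (LINT z|(LI \<Otimes>\<^sub>M LI). indicator (A \<times> B) z * f (snd z))"
    unfolding set_lebesgue_integral_def real_scaleR_def by (rule integral_LS) (rule borel_measurable_integrable[OF i2])
  also have "\<dots> = (LINT x|LI. LINT y|LI. indicator A x * (indicator B y * f y))"
    using LP.integral_fst'[OF i2]
    by (simp add: indicator_times algebra_simps)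
  also have "\<dots> = measure LI A * (LINT x:B|LI. f x)"
    unfolding set_lebesgue_integral_def by (simp add: meas[OF A] mult.commute)
  finally show "(LINT z:A \<times> B|LS. f (snd z)) = measure LI A * (LINT x:B|LI. f x)" .
qed

section \<open>Cells\<close>

lemma cell_sets:
  assumes "i \<in> {1..n}"
  shows "cell n i \<in> sets LI" and "cell n i \<subseteq> Omega" and "measure LI (cell n i) = 1 / real n"
proof -
  have n: "real n > 0" and i: "1 \<le> real i" "real i \<le> real n" using assms by auto
  show sub: "cell n i \<subseteq> Omega"
  proof
    fix x assume "x \<in> cell n i"
    then have "(real i - 1) / real n \<le> x" "x < real i / real n" by (auto simp: cell_def)
    moreover have "0 \<le> (real i - 1) / real n" "real i / real n \<le> 1" using n i by simp_all
    ultimately show "x \<in> Omega" by auto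
  qed
  then show "cell n i \<in> sets LI"
    by (simp add: sets_LI) (simp add: cell_def)
  have "measure LI (cell n i) = measure lebesgue (cell n i)"
    by (rule measure_restrict_space) (use sub in auto)
  also have "\<dots> = real i / real n - (real i - 1) / real n"
    using n by (simp add: cell_def divide_right_mono)
  finally show "measure LI (cell n i) = 1 / real n"
    using n by (simp add: diff_divide_distrib)
qed

text \<open>The cells are the level sets of the floor of n x, shifted by one because indices start
  at 1. Being half-open, they leave the point 1 uncovered.\<close>

lemma cell_unique:
  assumes n: "n \<ge> 1" and x: "0 \<le> x" "x < 1"
  shows "\<exists>!i. i \<in> {1..n} \<and> x \<in> cell n i"
proof -
  have np: "real n > 0" using n by simp
  have iff: "x \<in> cell n i \<longleftrightarrow> \<lfloor>real n * x\<rfloor> = int i - 1" for i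
    unfolding floor_eq_iff cell_def using np by (simp add: pos_divide_le_eq pos_less_divide_eq mult.commute)
  have "0 \<le> \<lfloor>real n * x\<rfloor>" "\<lfloor>real n * x\<rfloor> < int n"
    using np x by (auto simp: floor_less_iff)
  then show ?thesis
    unfolding iff by (intro ex1I[of _ "nat (\<lfloor>real n * x\<rfloor> + 1)"]) (auto simp: le_nat_iff)
qed

text \<open>The weight f is arbitrary because of two uses: f = 1 gives the partition of unity behind
  the cell decompositions, and f = v gives the values of \<open>inj1 n v\<close>.\<close>

lemma sum_indicator_cells:
  assumes "n \<ge> 1" "0 \<le> x" "x < 1"
  shows "(\<Sum>i=1..n. f i * indicator (cell n i) x) = (f (THE i. i \<in> {1..n} \<and> x \<in> cell n i) :: real)"
proof -
  define k where "k = (THE i. i \<in> {1..n} \<and> x \<in> cell n i)"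
  have k: "k \<in> {1..n}" "x \<in> cell n k"
    using theI'[OF cell_unique[OF assms]] by (auto simp: k_def)
  have "(\<Sum>i=1..n. f i * indicator (cell n i) x) = (\<Sum>i=1..n. if i = k then f i else 0)"
    by (rule sum.cong) (use k cell_unique[OF assms] in \<open>auto simp: indicator_def\<close>)
  then show ?thesis using k by (simp add: k_def)
qed

lemma inj1_cell:
  assumes "i \<in> {1..n}" "x \<in> cell n i"
  shows "inj1 n v x = v i"
proof -
  have n: "n \<ge> 1" using assms by auto
  have x: "0 \<le> x" "x < 1"
  proof -
    show "0 \<le> x" using cell_sets(2)[OF assms(1)] assms(2) by auto
    have "x < real i / real n" using assms(2) by (simp add: cell_def)
    also have "\<dots> \<le> 1" using assms(1) by simp
    finally show "x < 1" .
  qed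
  show ?thesis
    unfolding inj1_def sum_indicator_cells[OF n x]
    using the1_equality[OF cell_unique[OF n x]] assms by auto
qed

lemma inj2_cell:
  assumes "i \<in> {1..n}" "j \<in> {1..n}" "z \<in> cell n i \<times> cell n j"
  shows "inj2 n F z = F i j"
proof -
  \<comment> \<open>The indicator of a rectangle factors, so the double sum is an injection in each
    variable in turn.\<close>
  have "inj2 n F z = inj1 n (\<lambda>i. inj1 n (F i) (snd z)) (fst z)"
    unfolding inj1_def inj2_def indicator_times sum_distrib_right by (simp only: mult_ac)
  then show ?thesis using assms by (auto simp: inj1_cell)
qed

text \<open>The endpoint 1 lies in no cell, so decompositions into cells hold only almost
  everywhere; on the square the exceptional set consists of two edges.\<close>

lemma AE_LI_less_1: "AE x in LI. 0 \<le> x \<and> x < 1"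
proof (rule AE_I)
  show "{x \<in> space LI. \<not> (0 \<le> x \<and> x < 1)} \<subseteq> {1}" by auto
  show "emeasure LI {1} = 0" by (simp add: emeasure_restrict_space)
  show "{1} \<in> sets LI" by (simp add: sets_LI)
qed

lemma AE_LS_less_1: "AE z in LS. 0 \<le> fst z \<and> fst z < 1 \<and> 0 \<le> snd z \<and> snd z < 1"
proof -
  have 1: "emeasure LS (Omega \<times> {1}) = 0" "emeasure LS ({1} \<times> Omega) = 0"
    "Omega \<times> {1} \<in> sets LS" "{1} \<times> Omega \<in> sets LS"
    by (auto simp: Times_LS sets_LI emeasure_restrict_space)
  have "(Omega \<times> {1}) \<union> ({1} \<times> Omega) \<in> null_sets LS"
    by (rule null_sets.Un) (use 1 in \<open>auto simp only: null_sets_def\<close>)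
  then show ?thesis
    by (rule AE_I') auto
qed

section \<open>Integrals as sums over cells\<close>

lemma integral_cells1:
  fixes f :: "real \<Rightarrow> real"
  assumes n: "n \<ge> 1" and f: "integrable LI f"
  shows "integral\<^sup>L LI f = (\<Sum>i=1..n. LINT x:cell n i|LI. f x)"
proof -
  have [measurable]: "f \<in> borel_measurable LI" using f by (rule borel_measurable_integrable)
  have [measurable]: "cell n i \<in> sets LI" if "i \<in> {1..n}" for i using cell_sets[OF that] by simp
  have "integral\<^sup>L LI f = (LINT x|LI. (\<Sum>i=1..n. indicator (cell n i) x * f x))"
  proof (rule integral_cong_AE)
    show "AE x in LI. f x = (\<Sum>i=1..n. indicator (cell n i) x * f x)"
      using AE_LI_less_1
      by eventually_elim (use sum_indicator_cells[OF n, where f="\<lambda>_. 1"] in \<open>simp add: sum_distrib_right[symmetric]\<close>)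
  qed measurable
  also have "\<dots> = (\<Sum>i=1..n. LINT x:cell n i|LI. f x)"
    unfolding set_lebesgue_integral_def real_scaleR_def
    by (rule Bochner_Integration.integral_sum)
       (use integrable_real_mult_indicator[OF _ f] in \<open>simp add: mult.commute cell_sets(1)\<close>)
  finally show ?thesis .
qed

lemma integral_cells2:
  fixes F :: "real \<times> real \<Rightarrow> real"
  assumes n: "n \<ge> 1" and F: "integrable LS F"
  shows "integral\<^sup>L LS F = (\<Sum>i=1..n. \<Sum>j=1..n. LINT z:cell n i \<times> cell n j|LS. F z)"
proof -
  have [measurable]: "F \<in> borel_measurable LS" using F by (rule borel_measurable_integrable)
  have c [measurable]: "cell n i \<times> cell n j \<in> sets LS" if "i \<in> {1..n}" "j \<in> {1..n}" for i j
    using that by (intro Times_LS cell_sets)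
  have i: "integrable LS (\<lambda>z. indicator (cell n i \<times> cell n j) z * F z)"
    if "i \<in> {1..n}" "j \<in> {1..n}" for i j
    using integrable_real_mult_indicator[OF c[OF that] F] by (subst mult.commute)
  have "integral\<^sup>L LS F
      = (LINT z|LS. (\<Sum>i=1..n. \<Sum>j=1..n. indicator (cell n i \<times> cell n j) z * F z))"
  proof (rule integral_cong_AE)
    show "AE z in LS. F z = (\<Sum>i=1..n. \<Sum>j=1..n. indicator (cell n i \<times> cell n j) z * F z)"
      using AE_LS_less_1
    proof eventually_elim
      case (elim z)
      have "(\<Sum>i=1..n. \<Sum>j=1..n. indicator (cell n i \<times> cell n j) z * F z)
        = (\<Sum>i=1..n. indicator (cell n i) (fst z)) * (\<Sum>j=1..n. indicator (cell n j) (snd z)) * F z"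
        unfolding indicator_times sum_product unfolding sum_distrib_right ..
      also have "\<dots> = F z"
        using sum_indicator_cells[OF n, where f="\<lambda>_. 1"] elim by simp
      finally show ?case by simp
    qed
    show "(\<lambda>z. \<Sum>i=1..n. \<Sum>j=1..n. indicator (cell n i \<times> cell n j) z * F z) \<in> borel_measurable LS"
      using i by (intro borel_measurable_sum borel_measurable_integrable) 
  qed measurable
  also have "\<dots> = (\<Sum>i=1..n. LINT z|LS. (\<Sum>j=1..n. indicator (cell n i \<times> cell n j) z * F z))"
    by (intro Bochner_Integration.integral_sum Bochner_Integration.integrable_sum i)
  also have "\<dots> = (\<Sum>i=1..n. \<Sum>j=1..n. LINT z:cell n i \<times> cell n j|LS. F z)"
    unfolding set_lebesgue_integral_def real_scaleR_def
    by (intro sum.cong refl Bochner_Integration.integral_sum i)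
  finally show ?thesis .
qed

text \<open>The projectors integrate against Lebesgue measure on the whole space, the norms and
  energies against its restriction; this reconciles the two.\<close>

lemma set_integral_restrict_lebesgue:
  fixes f :: "'a::euclidean_space \<Rightarrow> real"
  assumes "A \<subseteq> S" "S \<in> sets lebesgue"
  shows "(LINT x:A|lebesgue. f x) = (LINT x:A|lebesgue_on S. f x)"
proof -
  have "(LINT x:A|lebesgue_on S. f x) = (LINT x|lebesgue. indicator S x * (indicator A x * f x))"
    unfolding set_lebesgue_integral_def real_scaleR_def
    using assms(2) by (subst integral_restrict_space) auto
  also have "\<dots> = (LINT x:A|lebesgue. f x)"
    unfolding set_lebesgue_integral_def real_scaleR_def
    by (rule Bochner_Integration.integral_cong) (use assms(1) in \<open>auto simp: indicator_def\<close>)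
  finally show ?thesis by simp
qed

lemma proj1_LI: "i \<in> {1..n} \<Longrightarrow> (LINT x:cell n i|LI. v x) = proj1 n v i / real n"
  unfolding proj1_def
  by (subst set_integral_restrict_lebesgue[OF cell_sets(2) Omega_sets(1)]) simp_all

lemma proj2_LS:
  assumes "i \<in> {1..n}" "j \<in> {1..n}"
  shows "(LINT z:cell n i \<times> cell n j|LS. F z) = proj2 n F i j / (real n)\<^sup>2"
  unfolding proj2_def
  by (subst set_integral_restrict_lebesgue[OF Sigma_mono[OF cell_sets(2)[OF assms(1)] cell_sets(2)[OF assms(2)]] Omega_sets(2)])
     (use assms in simp)

lemma measurable_inj1 [measurable]: "inj1 n v \<in> borel_measurable LI"
proof -
  have "(\<lambda>x. \<Sum>i=1..n. v i * indicator (cell n i) x) \<in> borel_measurable LI"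
    by (intro borel_measurable_sum borel_measurable_times borel_measurable_indicator
          borel_measurable_const cell_sets(1))
  then show ?thesis unfolding inj1_def[abs_def] .
qed

lemma inj1_bounded: "\<bar>inj1 n v x\<bar> \<le> (\<Sum>i=1..n. \<bar>v i\<bar>)"
  unfolding inj1_def by (rule order.trans[OF sum_abs sum_mono]) (auto simp: indicator_def)

lemma measurable_inj2 [measurable]: "inj2 n F \<in> borel_measurable LS"
proof -
  have "(\<lambda>x. \<Sum>i=1..n. \<Sum>j=1..n. F i j * indicator (cell n i \<times> cell n j) x) \<in> borel_measurable LS"
    by (intro borel_measurable_sum borel_measurable_times borel_measurable_indicator
          borel_measurable_const Times_LS(1) cell_sets(1))
  then show ?thesis unfolding inj2_def[abs_def] .
qed

lemma inj2_bounded: "\<bar>inj2 n F z\<bar> \<le> (\<Sum>i=1..n. \<Sum>j=1..n. \<bar>F i j\<bar>)"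
  unfolding inj2_def
  by (rule order.trans[OF sum_abs sum_mono], rule order.trans[OF sum_abs sum_mono])
     (auto simp: indicator_def)

section \<open>Norms and inequalities\<close>

lemma abs_powr_2: "\<bar>x::real\<bar> powr 2 = x\<^sup>2"
  by (cases "x = 0") (simp_all add: powr_numeral)

text \<open>Passage from extended to real values: with the integral finite, all estimates can be
  carried out in the reals.\<close>

lemma Lnorm_eq:
  assumes r: "r > 0" and f: "integrable M (\<lambda>x. \<bar>f x\<bar> powr r)"
  shows "Lnorm M (ennreal r) f = ennreal ((LINT x|M. \<bar>f x\<bar> powr r) powr (1 / r))"
proof -
  have I: "(\<integral>\<^sup>+ x. ennreal (\<bar>f x\<bar> powr r) \<partial>M) = ennreal (LINT x|M. \<bar>f x\<bar> powr r)"
    by (rule nn_integral_eq_integral[OF f]) simp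
  have "0 \<le> (LINT x|M. \<bar>f x\<bar> powr r)" by simp
  then show ?thesis
    using r by (simp add: Lnorm_def Let_def I)
qed

lemma Lnorm_finite_imp_integrable:
  assumes r: "r > 0" and f: "f \<in> borel_measurable M" and fin: "Lnorm M (ennreal r) f < \<infinity>"
  shows "integrable M (\<lambda>x. \<bar>f x\<bar> powr r)"
proof (rule integrableI_bounded)
  show "(\<lambda>x. \<bar>f x\<bar> powr r) \<in> borel_measurable M" using f by measurable
  show "(\<integral>\<^sup>+ x. ennreal (norm (\<bar>f x\<bar> powr r)) \<partial>M) < \<infinity>"
    using fin r by (simp add: Lnorm_def Let_def less_top split: if_splits)
qed

lemma L2_iff:
  "u \<in> L2 \<longleftrightarrow> u \<in> borel_measurable LI \<and> integrable LI (\<lambda>x. (u x)\<^sup>2)"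
  using Lnorm_finite_imp_integrable[of 2 u LI] Lnorm_eq[of 2 LI u]
  unfolding L2_def abs_powr_2 by (auto simp: less_top)

lemma Lnorm_2_squared:
  assumes "integrable M (\<lambda>x. (f x)\<^sup>2)"
  shows "(Lnorm M 2 f)\<^sup>2 = ennreal (LINT x|M. (f x)\<^sup>2)"
proof -
  have "0 \<le> (LINT x|M. (f x)\<^sup>2)" by simp
  then have "((LINT x|M. (f x)\<^sup>2) powr (1 / 2))\<^sup>2 = (LINT x|M. (f x)\<^sup>2)"
    by (simp add: powr_half_sqrt)
  then show ?thesis
    using Lnorm_eq[of 2 M f] assms by (simp add: abs_powr_2 ennreal_power)
qed

text \<open>The triangle inequality and monotonicity reduce the claim to absolute values, that is,
  to convexity of the power on the half-line.\<close>

lemma convex_on_abs_powr: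
  fixes p :: real
  assumes p: "p \<ge> 1"
  shows "convex_on UNIV (\<lambda>x. \<bar>x\<bar> powr p)"
proof (rule convex_onI)
  fix t x y :: real
  assume t: "0 < t" "t < 1"
  have tp: "s powr p \<le> s" if "0 < s" "s < 1" for s :: real
    using powr_mono'[of 1 p s] p that by simp
  have "\<bar>(1 - t) *\<^sub>R x + t *\<^sub>R y\<bar> \<le> (1 - t) * \<bar>x\<bar> + t * \<bar>y\<bar>"
    using abs_triangle_ineq[of "(1 - t) * x" "t * y"] t by (simp add: abs_mult)
  then have "\<bar>(1 - t) *\<^sub>R x + t *\<^sub>R y\<bar> powr p \<le> ((1 - t) * \<bar>x\<bar> + t * \<bar>y\<bar>) powr p"
    using p by (intro powr_mono2) auto
  also have "\<dots> \<le> (1 - t) * \<bar>x\<bar> powr p + t * \<bar>y\<bar> powr p"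
  \<comment> \<open>\<open>powr_convex\<close> is applied at positive arguments. If one of the two
    points is 0, the claim reduces to \<open>t powr p \<le> t\<close> or to the same inequality for
    1 - t.\<close>
  proof (cases "x = 0 \<or> y = 0")
    case True
    then show ?thesis
      using t tp[of t] tp[of "1 - t"]
      by (auto simp: powr_mult intro!: mult_right_mono)
  next
    case False
    then show ?thesis
      using convex_onD[OF powr_convex[OF p], of t "\<bar>x\<bar>" "\<bar>y\<bar>"] t by simp
  qed
  finally show "\<bar>(1 - t) *\<^sub>R x + t *\<^sub>R y\<bar> powr p \<le> (1 - t) * \<bar>x\<bar> powr p + t * \<bar>y\<bar> powr p" .
qed simp

text \<open>A supporting line at x, also at the kink x = 0 for p = 1. Taken at a mean value and
  integrated, it yields Jensen's inequality.\<close>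

lemma abs_powr_subgradient:
  fixes p :: real
  assumes "p \<ge> 1"
  obtains c where "\<And>y. \<bar>x\<bar> powr p + c * (y - x) \<le> \<bar>y\<bar> powr p"
  using convex_le_Inf_differential[OF convex_on_abs_powr[OF assms], of x] by auto

text \<open>Young's inequality, integrated after both functions are scaled to norm 1. If one norm
  vanishes, the product is 0 almost everywhere.\<close>

lemma Hoelder:
  fixes f h :: "'a \<Rightarrow> real"
  assumes rs: "r > 1" "s > 1" "1 / r + 1 / s = 1"
    and f: "f \<in> borel_measurable M" "integrable M (\<lambda>x. \<bar>f x\<bar> powr r)"
    and h: "h \<in> borel_measurable M" "integrable M (\<lambda>x. \<bar>h x\<bar> powr s)"
  shows "integrable M (\<lambda>x. \<bar>f x\<bar> * \<bar>h x\<bar>)"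
    and "(LINT x|M. \<bar>f x\<bar> * \<bar>h x\<bar>)
      \<le> (LINT x|M. \<bar>f x\<bar> powr r) powr (1 / r) * (LINT x|M. \<bar>h x\<bar> powr s) powr (1 / s)"
proof -
  note [measurable] = f(1) h(1)
  show int: "integrable M (\<lambda>x. \<bar>f x\<bar> * \<bar>h x\<bar>)"
  proof (rule Bochner_Integration.integrable_bound)
    show "integrable M (\<lambda>x. \<bar>f x\<bar> powr r / r + \<bar>h x\<bar> powr s / s)"
      using f h by simp
    have "\<bar>f x\<bar> * \<bar>h x\<bar> \<le> \<bar>f x\<bar> powr r / r + \<bar>h x\<bar> powr s / s" for x
      using rs by (intro Youngs_inequality) auto
    moreover have "0 \<le> \<bar>f x\<bar> powr r / r + \<bar>h x\<bar> powr s / s" for x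
      using rs by (intro add_nonneg_nonneg divide_nonneg_pos) auto
    ultimately show "AE x in M. norm (\<bar>f x\<bar> * \<bar>h x\<bar>) \<le> norm (\<bar>f x\<bar> powr r / r + \<bar>h x\<bar> powr s / s)"
      by (auto simp: abs_mult)
  qed measurable
  define A where "A = (LINT x|M. \<bar>f x\<bar> powr r)"
  define B where "B = (LINT x|M. \<bar>h x\<bar> powr s)"
  have AB: "A \<ge> 0" "B \<ge> 0" by (auto simp: A_def B_def)
  have zero: "(LINT x|M. \<bar>f x\<bar> * \<bar>h x\<bar>) = 0"
    if "AE x in M. f x = 0 \<or> h x = 0"
    by (rule integral_eq_zero_AE) (use that in auto)
  consider "A = 0" | "B = 0" | "A > 0" "B > 0" using AB by linarith
  then have "(LINT x|M. \<bar>f x\<bar> * \<bar>h x\<bar>) \<le> A powr (1 / r) * B powr (1 / s)"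
  proof cases
    case 1
    then have "AE x in M. \<bar>f x\<bar> powr r = 0"
      using integral_nonneg_eq_0_iff_AE[OF f(2)] by (auto simp: A_def)
    then have "AE x in M. f x = 0 \<or> h x = 0" by eventually_elim auto
    then show ?thesis using zero by simp
  next
    case 2
    then have "AE x in M. \<bar>h x\<bar> powr s = 0"
      using integral_nonneg_eq_0_iff_AE[OF h(2)] by (auto simp: B_def)
    then have "AE x in M. f x = 0 \<or> h x = 0" by eventually_elim auto
    then show ?thesis using zero by simp
  next
    case 3
    \<comment> \<open>The norms of f and h. After division by them the two Young terms integrate to
      1/r and 1/s, whose sum is 1.\<close>
    define a where "a = A powr (1 / r)"
    define b where "b = B powr (1 / s)"
    have ab: "a > 0" "b > 0" using 3 by (auto simp: a_def b_def)
    have pow: "a powr r = A" "b powr s = B"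
      using 3 rs by (auto simp: a_def b_def powr_powr)
    have "(LINT x|M. \<bar>f x\<bar> * \<bar>h x\<bar>) = (LINT x|M. a * b * ((\<bar>f x\<bar> / a) * (\<bar>h x\<bar> / b)))"
      using ab by simp
    also have "\<dots> \<le> (LINT x|M. a * b * (\<bar>f x\<bar> powr r / (A * r) + \<bar>h x\<bar> powr s / (B * s)))"
    proof (rule integral_mono)
      show "integrable M (\<lambda>x. a * b * ((\<bar>f x\<bar> / a) * (\<bar>h x\<bar> / b)))"
        using int ab by simp
      show "integrable M (\<lambda>x. a * b * (\<bar>f x\<bar> powr r / (A * r) + \<bar>h x\<bar> powr s / (B * s)))"
        using f h by simp
      fix x
      have "(\<bar>f x\<bar> / a) * (\<bar>h x\<bar> / b) \<le> (\<bar>f x\<bar> / a) powr r / r + (\<bar>h x\<bar> / b) powr s / s"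
        using rs ab by (intro Youngs_inequality) auto
      also have "\<dots> = \<bar>f x\<bar> powr r / (A * r) + \<bar>h x\<bar> powr s / (B * s)"
        using ab by (simp add: powr_divide pow)
      finally show "a * b * ((\<bar>f x\<bar> / a) * (\<bar>h x\<bar> / b))
          \<le> a * b * (\<bar>f x\<bar> powr r / (A * r) + \<bar>h x\<bar> powr s / (B * s))"
        using ab by (intro mult_left_mono) auto
    qed
    also have "\<dots> = a * b * (A / (A * r) + B / (B * s))"
      using f h by (simp add: A_def B_def)
    also have "\<dots> = a * b * (1 / r + 1 / s)" using 3 by simp
    finally show ?thesis using rs by (simp add: a_def b_def)
  qed
  then show "(LINT x|M. \<bar>f x\<bar> * \<bar>h x\<bar>)
      \<le> (LINT x|M. \<bar>f x\<bar> powr r) powr (1 / r) * (LINT x|M. \<bar>h x\<bar> powr s) powr (1 / s)"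
    by (simp add: A_def B_def)
qed

text \<open>The endpoint of Hoelder's inequality with exponents infinity and 1.\<close>

lemma L_infinity_bound:
  fixes f h :: "'a \<Rightarrow> real"
  assumes f: "f \<in> borel_measurable M" and fin: "Lnorm M \<infinity> f < \<infinity>" and h: "integrable M h"
  shows "integrable M (\<lambda>x. \<bar>f x\<bar> * \<bar>h x\<bar>)"
    and "(LINT x|M. \<bar>f x\<bar> * \<bar>h x\<bar>) \<le> enn2real (Lnorm M \<infinity> f) * (LINT x|M. \<bar>h x\<bar>)"
proof -
  define e where "e = enn2real (Lnorm M \<infinity> f)"
  have e: "e \<ge> 0" "Lnorm M \<infinity> f = ennreal e"
    using fin by (auto simp: e_def)
  have "AE x in M. ennreal \<bar>f x\<bar> \<le> ennreal e"
    using esssup_AE[of "\<lambda>x. ennreal \<bar>f x\<bar>" M] e by (simp add: Lnorm_def)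
  then have ae: "AE x in M. \<bar>f x\<bar> * \<bar>h x\<bar> \<le> e * \<bar>h x\<bar>"
    by eventually_elim (use e in \<open>auto intro: mult_right_mono\<close>)
  have ih: "integrable M (\<lambda>x. e * \<bar>h x\<bar>)" using h by simp
  show int: "integrable M (\<lambda>x. \<bar>f x\<bar> * \<bar>h x\<bar>)"
  proof (rule Bochner_Integration.integrable_bound[OF ih])
    show "AE x in M. norm (\<bar>f x\<bar> * \<bar>h x\<bar>) \<le> norm (e * \<bar>h x\<bar>)"
      using ae by eventually_elim (use e in \<open>auto simp: abs_mult\<close>)
  qed (use f borel_measurable_integrable[OF h] in measurable)
  have "(LINT x|M. \<bar>f x\<bar> * \<bar>h x\<bar>) \<le> (LINT x|M. e * \<bar>h x\<bar>)"
    by (rule integral_mono_AE[OF int ih ae])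
  then show "(LINT x|M. \<bar>f x\<bar> * \<bar>h x\<bar>) \<le> enn2real (Lnorm M \<infinity> f) * (LINT x|M. \<bar>h x\<bar>)"
    by (simp add: e_def)
qed

section \<open>The vector space \<open>L2\<close>\<close>

lemma integrable_square_combination:
  fixes f h :: "'a \<Rightarrow> real"
  assumes f: "f \<in> borel_measurable M" "integrable M (\<lambda>x. (f x)\<^sup>2)"
    and h: "h \<in> borel_measurable M" "integrable M (\<lambda>x. (h x)\<^sup>2)"
  shows "integrable M (\<lambda>x. (a * f x + b * h x)\<^sup>2)"
proof (rule Bochner_Integration.integrable_bound)
  show "integrable M (\<lambda>x. 2 * a\<^sup>2 * (f x)\<^sup>2 + 2 * b\<^sup>2 * (h x)\<^sup>2)"
    using f h by simp
  \<comment> \<open>The right side minus the left side is the square of a f - b h.\<close>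
  have "(a * f x + b * h x)\<^sup>2 \<le> 2 * a\<^sup>2 * (f x)\<^sup>2 + 2 * b\<^sup>2 * (h x)\<^sup>2" for x
    using zero_le_power2[of "a * f x - b * h x"] by (simp add: power2_eq_square algebra_simps)
  then show "AE x in M. norm ((a * f x + b * h x)\<^sup>2)
      \<le> norm (2 * a\<^sup>2 * (f x)\<^sup>2 + 2 * b\<^sup>2 * (h x)\<^sup>2)"
    by auto
qed (use f(1) h(1) in measurable)

lemma L2_combination: "u \<in> L2 \<Longrightarrow> v \<in> L2 \<Longrightarrow> (\<lambda>x. a * u x + b * v x) \<in> L2"
  unfolding L2_iff
  by (intro conjI borel_measurable_add borel_measurable_times borel_measurable_const
      integrable_square_combination) auto

lemma L2_diff: "u \<in> L2 \<Longrightarrow> v \<in> L2 \<Longrightarrow> (\<lambda>x. u x - v x) \<in> L2"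
  using L2_combination[of u v 1 "-1"] by simp

lemma L2_integrable:
  assumes "u \<in> L2" shows "integrable LI u"
  by (rule LI.square_integrable_imp_integrable) (use assms in \<open>auto simp only: L2_iff\<close>)

lemma bounded_in_L2:
  assumes u: "u \<in> borel_measurable LI" and b: "\<And>x. \<bar>u x\<bar> \<le> c"
  shows "u \<in> L2"
  unfolding L2_iff
proof
  show "integrable LI (\<lambda>x. (u x)\<^sup>2)"
  proof (rule LI.integrable_const_bound[of _ "c\<^sup>2"])
    show "AE x in LI. norm ((u x)\<^sup>2) \<le> c\<^sup>2"
      using power_mono[OF b abs_ge_zero, of _ 2] by (intro AE_I2) simp
    show "(\<lambda>x. (u x)\<^sup>2) \<in> borel_measurable LI" using u by (rule borel_measurable_power)
  qed
qed (rule u)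

lemma inj1_in_L2: "inj1 n v \<in> L2"
  using measurable_inj1 inj1_bounded by (rule bounded_in_L2)

section \<open>Projection onto the functions constant on the cells\<close>

text \<open>A real stand-in for the squared L2 norm, so that terms can be subtracted and cancelled.
  It is faithful only on \<open>L2\<close>, since the integral of a non-integrable function defaults
  to 0.\<close>

definition sqnorm :: "(real \<Rightarrow> real) \<Rightarrow> real" where
  "sqnorm f = (LINT x|LI. (f x)\<^sup>2)"

text \<open>The regularizer's integrand without its weight. The exponent is a parameter because
  \<open>incr p u\<close> raised to the power 2/p is \<open>incr 2 u\<close>.\<close>

definition incr :: "real \<Rightarrow> (real \<Rightarrow> real) \<Rightarrow> real \<times> real \<Rightarrow> real" where
  "incr p u z = \<bar>u (snd z) - u (fst z)\<bar> powr p"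

lemma incr_nonneg: "0 \<le> incr p u z"
  by (simp add: incr_def)

lemma sqnorm_nonneg: "0 \<le> sqnorm f"
  by (simp add: sqnorm_def)

lemma measurable_incr:
  assumes "u \<in> borel_measurable LI"
  shows "incr p u \<in> borel_measurable LS"
proof -
  note [measurable] = measurable_LS_fst[OF assms] measurable_LS_snd[OF assms]
  show ?thesis unfolding incr_def[abs_def] by measurable
qed

lemma L2_D: "u \<in> L2 \<Longrightarrow> u \<in> borel_measurable LI" "u \<in> L2 \<Longrightarrow> integrable LI (\<lambda>x. (u x)\<^sup>2)"
  by (auto simp only: L2_iff)

lemma Lnorm_sqnorm: "u \<in> L2 \<Longrightarrow> (Lnorm LI 2 u)\<^sup>2 = ennreal (sqnorm u)"
  unfolding sqnorm_def by (intro Lnorm_2_squared L2_D)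

lemma sqnorm_sum_le:
  assumes "f \<in> L2" "h \<in> L2"
  shows "sqnorm (\<lambda>x. f x + h x) \<le> 2 * sqnorm f + 2 * sqnorm h"
proof -
  have "sqnorm (\<lambda>x. f x + h x) \<le> (LINT x|LI. 2 * (f x)\<^sup>2 + 2 * (h x)\<^sup>2)"
    unfolding sqnorm_def
  proof (rule integral_mono)
    show "integrable LI (\<lambda>x. (f x + h x)\<^sup>2)"
      using L2_combination[OF assms, of 1 1] by (auto dest: L2_D(2))
    show "integrable LI (\<lambda>x. 2 * (f x)\<^sup>2 + 2 * (h x)\<^sup>2)"
      by (intro Bochner_Integration.integrable_add integrable_mult_right L2_D assms)
    show "(f x + h x)\<^sup>2 \<le> 2 * (f x)\<^sup>2 + 2 * (h x)\<^sup>2" for x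
      using zero_le_power2[of "f x - h x"] by (simp add: power2_eq_square algebra_simps)
  qed
  also have "\<dots> = 2 * sqnorm f + 2 * sqnorm h"
    unfolding sqnorm_def
    by (subst Bochner_Integration.integral_add)
       (simp_all add: L2_D(2) assms)
  finally show ?thesis .
qed

text \<open>From (a - b)^2 \<le> 2 a^2 + 2 b^2. Each term depends on one variable only, and the
  other variable has total mass 1.\<close>

lemma integral_incr_2:
  assumes u: "u \<in> L2"
  shows "integrable LS (incr 2 u)" and "(LINT z|LS. incr 2 u z) \<le> 4 * sqnorm u"
proof -
  have eq: "incr 2 u z = (u (snd z) - u (fst z))\<^sup>2" for z
    by (simp add: incr_def abs_powr_2)
  have le: "incr 2 u z \<le> 2 * (u (snd z))\<^sup>2 + 2 * (u (fst z))\<^sup>2" for z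
    unfolding eq using zero_le_power2[of "u (snd z) + u (fst z)"]
    by (simp add: power2_eq_square algebra_simps)
  have Omega: "Omega \<in> sets LI" by (simp add: sets_LI)
  note sq = integral_rectangle[OF L2_D(2)[OF u] Omega Omega]
  have i: "integrable LS (\<lambda>z. 2 * (u (snd z))\<^sup>2 + 2 * (u (fst z))\<^sup>2)"
    by (intro Bochner_Integration.integrable_add integrable_mult_right sq)
  show int: "integrable LS (incr 2 u)"
  proof (rule Bochner_Integration.integrable_bound[OF i])
    show "AE z in LS. norm (incr 2 u z) \<le> norm (2 * (u (snd z))\<^sup>2 + 2 * (u (fst z))\<^sup>2)"
      using le by (simp add: incr_nonneg)
  qed (rule measurable_incr[OF L2_D(1)[OF u]])
  have full: "set_lebesgue_integral (lebesgue_on S) S f = integral\<^sup>L (lebesgue_on S) f"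
    for S :: "'b::euclidean_space set" and f :: "'b \<Rightarrow> real"
    unfolding set_lebesgue_integral_def by (rule Bochner_Integration.integral_cong) auto
  have m1: "measure LI Omega = 1" using LI.prob_space by simp
  have "(LINT z|LS. incr 2 u z) \<le> (LINT z|LS. 2 * (u (snd z))\<^sup>2 + 2 * (u (fst z))\<^sup>2)"
    by (rule integral_mono[OF int i le])
  also have "\<dots> = 2 * (LINT z|LS. (u (snd z))\<^sup>2) + 2 * (LINT z|LS. (u (fst z))\<^sup>2)"
    by (subst Bochner_Integration.integral_add[OF integrable_mult_right[OF sq(2)] integrable_mult_right[OF sq(1)]])
       (simp only: Bochner_Integration.integral_mult_right_zero)
  also have "\<dots> = 4 * sqnorm u"
    using sq(3,4) by (simp add: full m1 sqnorm_def)
  finally show "(LINT z|LS. incr 2 u z) \<le> 4 * sqnorm u" .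
qed

text \<open>By s^p \<le> 1 + s^2 the squared increments dominate, the constant 1 being integrable on
  a probability space.\<close>

lemma integrable_incr_L2:
  assumes u: "u \<in> L2" and p: "1 \<le> p" "p \<le> 2"
  shows "integrable LS (incr p u)"
proof (rule Bochner_Integration.integrable_bound)
  show "integrable LS (\<lambda>z. 1 + incr 2 u z)"
    by (intro Bochner_Integration.integrable_add integral_incr_2[OF u]) simp
  have "s powr p \<le> 1 + s powr 2" if "s \<ge> 0" for s :: real
  proof (cases "s \<le> 1")
    case True
    then have "s powr p \<le> 1" using powr_mono2[of p s 1] p that by simp
    then show ?thesis by (simp add: add_increasing2)
  next
    case False
    then have "s powr p \<le> s powr 2" using p by (intro powr_mono) auto
    then show ?thesis by simp
  qed
  from this[OF abs_ge_zero] have "norm (incr p u z) \<le> norm (1 + incr 2 u z)" for z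
    by (simp add: incr_def)
  then show "AE z in LS. norm (incr p u z) \<le> norm (1 + incr 2 u z)" by simp
qed (rule measurable_incr[OF L2_D(1)[OF u]])

text \<open>Orthogonality of \<open>f - I_n P_n f\<close> to the functions constant on the cells.\<close>
lemma sqnorm_inj1_diff:
  assumes n: "n \<ge> 1" and f: "f \<in> L2"
  shows "sqnorm (\<lambda>x. inj1 n v x - f x)
    = (\<Sum>i=1..n. (v i - proj1 n f i)\<^sup>2) / real n + sqnorm (\<lambda>x. f x - inj1 n (proj1 n f) x)"
proof -
  have L: "(\<lambda>x. inj1 n v x - f x) \<in> L2" "(\<lambda>x. f x - inj1 n (proj1 n f) x) \<in> L2"
    by (intro L2_diff inj1_in_L2 f)+
  have cell: "(LINT x:cell n i|LI. (inj1 n v x - f x)\<^sup>2)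
      = (v i - proj1 n f i)\<^sup>2 / real n + (LINT x:cell n i|LI. (f x - inj1 n (proj1 n f) x)\<^sup>2)"
    if i: "i \<in> {1..n}" for i
  proof -
    let ?m = "proj1 n f i"
    have sets: "cell n i \<in> sets LI" by (rule cell_sets(1)[OF i])
    have si: "set_integrable LI (cell n i) h" if "integrable LI h" for h :: "real \<Rightarrow> real"
      unfolding set_integrable_def by (rule integrable_mult_indicator[OF sets that])
    \<comment> \<open>With m the mean of f, (v - f)^2 and (f - m)^2 differ by an expression affine
      in f, so the mean alone determines its integral over the cell.\<close>
    have "(LINT x:cell n i|LI. (inj1 n v x - f x)\<^sup>2)
      = (LINT x:cell n i|LI. (f x - inj1 n (proj1 n f) x)\<^sup>2 + ((v i)\<^sup>2 - ?m\<^sup>2 - 2 * (v i - ?m) * f x))"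
      by (rule set_lebesgue_integral_cong[OF sets])
         (auto simp: inj1_cell[OF i] power2_eq_square algebra_simps)
    also have "\<dots> = (LINT x:cell n i|LI. (f x - inj1 n (proj1 n f) x)\<^sup>2)
        + (LINT x:cell n i|LI. (v i)\<^sup>2 - ?m\<^sup>2 - 2 * (v i - ?m) * f x)"
      by (rule set_integral_add) 
         (intro si L2_D L Bochner_Integration.integrable_diff integrable_mult_right L2_integrable f
           LI.integrable_const)+
    also have "(LINT x:cell n i|LI. (v i)\<^sup>2 - ?m\<^sup>2 - 2 * (v i - ?m) * f x)
        = (LINT x:cell n i|LI. (v i)\<^sup>2 - ?m\<^sup>2) - (LINT x:cell n i|LI. 2 * (v i - ?m) * f x)"
      by (rule set_integral_diff)
         (intro si integrable_mult_right L2_integrable f LI.integrable_const)+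
    also have "(LINT x:cell n i|LI. (v i)\<^sup>2 - ?m\<^sup>2) = ((v i)\<^sup>2 - ?m\<^sup>2) / real n"
      using cell_sets(2,3)[OF i] unfolding set_lebesgue_integral_def
      by (simp add: Int_absorb2)
    also have "(LINT x:cell n i|LI. 2 * (v i - ?m) * f x) = 2 * (v i - ?m) * (?m / real n)"
      by (simp only: set_integral_mult_right proj1_LI[OF i])
    also have "((v i)\<^sup>2 - ?m\<^sup>2) / real n - 2 * (v i - ?m) * (?m / real n) = (v i - ?m)\<^sup>2 / real n"
      using n by (simp add: power2_eq_square field_simps)
    finally show ?thesis by (simp only: add.commute)
  qed
  show ?thesis
    unfolding sqnorm_def integral_cells1[OF n L2_D(2)[OF L(1)]] integral_cells1[OF n L2_D(2)[OF L(2)]]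
    by (simp add: cell sum.distrib sum_divide_distrib)
qed

lemma proj1_diff:
  assumes i: "i \<in> {1..n}" and "integrable LI f" "integrable LI h"
  shows "proj1 n (\<lambda>x. f x - h x) i = proj1 n f i - proj1 n h i"
proof -
  have si: "set_integrable LI (cell n i) h" if "integrable LI h" for h :: "real \<Rightarrow> real"
    unfolding set_integrable_def by (rule integrable_mult_indicator[OF cell_sets(1)[OF i] that])
  have "(LINT x:cell n i|LI. f x - h x) = (LINT x:cell n i|LI. f x) - (LINT x:cell n i|LI. h x)"
    by (intro set_integral_diff si assms)
  then show ?thesis
    using i unfolding proj1_LI[OF i] by (simp add: field_simps)
qed

text \<open>Orthogonality for g splits the left side into the projected norm of u - g and the
  discretisation error of g. The same identity for u - g with v = 0 shows that projecting does not
  increase the norm.\<close>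

lemma sqnorm_inj1_proj1_diff_le:
  assumes n: "n \<ge> 1" and u: "u \<in> L2" and g: "g \<in> L2"
  shows "sqnorm (\<lambda>x. inj1 n (proj1 n u) x - g x)
    \<le> sqnorm (\<lambda>x. u x - g x) + sqnorm (\<lambda>x. g x - inj1 n (proj1 n g) x)"
proof -
  let ?f = "\<lambda>x. u x - g x"
  have "(\<Sum>i=1..n. (proj1 n u i - proj1 n g i)\<^sup>2) / real n = (\<Sum>i=1..n. (0 - proj1 n ?f i)\<^sup>2) / real n"
    by (intro arg_cong2[where f="(/)"] sum.cong refl)
       (simp only: proj1_diff L2_integrable u g diff_0 power2_minus)
  also have "\<dots> \<le> sqnorm (\<lambda>x. inj1 n (\<lambda>_. 0) x - ?f x)"
    unfolding sqnorm_inj1_diff[OF n L2_diff[OF u g]] using sqnorm_nonneg by simp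
  also have "\<dots> = sqnorm ?f"
    by (simp add: sqnorm_def inj1_def power2_commute)
  finally show ?thesis
    unfolding sqnorm_inj1_diff[OF n g] by simp
qed

lemma measure_cell_Times:
  assumes "i \<in> {1..n}" "j \<in> {1..n}"
  shows "cell n i \<times> cell n j \<in> sets LS" and "measure LS (cell n i \<times> cell n j) = 1 / (real n)\<^sup>2"
proof -
  note c = cell_sets[OF assms(1)] cell_sets[OF assms(2)]
  show "cell n i \<times> cell n j \<in> sets LS" by (rule Times_LS(1)[OF c(1,4)])
  have "measure LS (cell n i \<times> cell n j) = measure LI (cell n i) * measure LI (cell n j)"
    unfolding measure_def Times_LS(2)[OF c(1,4)] by (rule enn2real_mult)
  then show "measure LS (cell n i \<times> cell n j) = 1 / (real n)\<^sup>2"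
    by (simp only: c) (simp add: power2_eq_square)
qed

text \<open>Jensen's inequality for the mean of \<open>u y - u x\<close> over a product of cells.\<close>
lemma proj1_incr_le:
  assumes i: "i \<in> {1..n}" and j: "j \<in> {1..n}" and p: "p \<ge> 1"
    and u: "integrable LI u" and W: "integrable LS (incr p u)"
  shows "\<bar>proj1 n u j - proj1 n u i\<bar> powr p / (real n)\<^sup>2
    \<le> (LINT z:cell n i \<times> cell n j|LS. incr p u z)"
proof -
  let ?m = "proj1 n u j - proj1 n u i" and ?C = "cell n i \<times> cell n j"
  obtain c where c: "\<And>y. \<bar>?m\<bar> powr p + c * (y - ?m) \<le> \<bar>y\<bar> powr p"
    using abs_powr_subgradient[OF p] by blast
  note rect = integral_rectangle[OF u cell_sets(1)[OF i] cell_sets(1)[OF j]]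
  have sets: "?C \<in> sets LS" and meas: "measure LS ?C = 1 / (real n)\<^sup>2"
    using measure_cell_Times[OF i j] .
  have si: "set_integrable LS ?C h" if "integrable LS h" for h :: "real \<times> real \<Rightarrow> real"
    unfolding set_integrable_def by (rule integrable_mult_indicator[OF sets that])
  have const: "(LINT z:?C|LS. a) = a / (real n)\<^sup>2" for a :: real
    using meas sets.sets_into_space[OF sets] unfolding set_lebesgue_integral_def
    by (simp add: Int_absorb2)
  have n: "real n > 0" using i by simp
  \<comment> \<open>The supporting line at the mean \<open>?m\<close>, evaluated at the increment of
    u. Its linear part integrates to 0 over the product of cells, which leaves the value at the
    mean.\<close>
  let ?l = "\<lambda>z. (\<bar>?m\<bar> powr p - c * ?m) + (c * u (snd z) - c * u (fst z))"
  have "(LINT z:?C|LS. ?l z)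
      = (LINT z:?C|LS. \<bar>?m\<bar> powr p - c * ?m) + (LINT z:?C|LS. c * u (snd z) - c * u (fst z))"
    by (rule set_integral_add; intro si Bochner_Integration.integrable_diff integrable_mult_right rect
        LS.integrable_const)
  also have "(LINT z:?C|LS. c * u (snd z) - c * u (fst z))
      = (LINT z:?C|LS. c * u (snd z)) - (LINT z:?C|LS. c * u (fst z))"
    by (rule set_integral_diff; intro si integrable_mult_right rect)
  also have "(LINT z:?C|LS. \<bar>?m\<bar> powr p - c * ?m) + \<dots> = \<bar>?m\<bar> powr p / (real n)\<^sup>2"
    unfolding const set_integral_mult_right rect cell_sets(3)[OF i] cell_sets(3)[OF j]
      proj1_LI[OF i] proj1_LI[OF j]
    using n by (simp add: field_simps power2_eq_square)
  finally have "\<bar>?m\<bar> powr p / (real n)\<^sup>2 = (LINT z:?C|LS. ?l z)" ..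
  also have "\<dots> \<le> (LINT z:?C|LS. incr p u z)"
  proof (rule set_integral_mono)
    show "set_integrable LS ?C ?l"
      by (intro si Bochner_Integration.integrable_add Bochner_Integration.integrable_diff
          integrable_mult_right rect LS.integrable_const)
    show "set_integrable LS ?C (incr p u)" by (rule si[OF W])
    show "?l z \<le> incr p u z" for z
      using c[of "u (snd z) - u (fst z)"] by (simp add: incr_def algebra_simps)
  qed
  finally show ?thesis .
qed

section \<open>The error estimate\<close>

text \<open>Here p and lam are fixed, but the bounds carry explicit constants, so that uniformity in
  n and lam can be read off from their form.\<close>

locale nonlocal_problem =
  fixes g :: "real \<Rightarrow> real" and K :: "real \<times> real \<Rightarrow> real" and p lam :: real
  assumes g: "g \<in> L2"
    and K_nonneg: "\<And>z. z \<in> Omega \<times> Omega \<Longrightarrow> K z \<ge> 0"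
    and K_meas: "K \<in> borel_measurable LS"
    and K_bdd: "bounded (K ` (Omega \<times> Omega))"
    and p: "p \<ge> 1" and lam: "lam > 0"
begin

text \<open>Stripped of 1/(2p): after multiplication by 2 lam the energy reads
  \<open>sqnorm (\<lambda>x. u x - g x) + lam / p * R u\<close>.\<close>

definition R :: "(real \<Rightarrow> real) \<Rightarrow> real" where
  "R u = (LINT z|LS. K z * incr p u z)"

text \<open>Separates the infinite branch of the regularizer from \<open>R\<close>, which would
  silently be 0 there.\<close>

definition finite_R :: "(real \<Rightarrow> real) \<Rightarrow> bool" where
  "finite_R u \<longleftrightarrow> integrable LS (\<lambda>z. K z * incr p u z)"

lemma AE_K_nonneg: "AE z in LS. 0 \<le> K z"
  using K_nonneg by (intro AE_I2) simp

lemma R_nonneg: "0 \<le> R u"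
  unfolding R_def
  by (rule integral_nonneg_AE) (use AE_K_nonneg in \<open>eventually_elim, simp add: incr_nonneg\<close>)

lemma energy_eq:
  "energy p lam u g K =
    ennreal (1 / (2 * lam)) * (Lnorm LI 2 (\<lambda>x. u x - g x))\<^sup>2
    + (if finite_R u then ennreal (1 / (2 * p) * R u) else \<infinity>)"
proof -
  have "(\<lambda>(x, y). K (x, y) * \<bar>u y - u x\<bar> powr p) = (\<lambda>z. K z * incr p u z)"
    by (auto simp: incr_def)
  then show ?thesis
    by (simp only: energy_def regularizer_def finite_R_def R_def)
qed

lemma energy_finite:
  assumes u: "u \<in> L2" and R: "finite_R u"
  shows "energy p lam u g K = ennreal (1 / (2 * lam) * sqnorm (\<lambda>x. u x - g x) + 1 / (2 * p) * R u)"
proof -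
  have "0 \<le> 1 / (2 * lam) * sqnorm (\<lambda>x. u x - g x)" "0 \<le> 1 / (2 * p) * R u"
    using lam p sqnorm_nonneg R_nonneg by simp_all
  moreover have "ennreal (1 / (2 * lam)) * ennreal (sqnorm (\<lambda>x. u x - g x))
      = ennreal (1 / (2 * lam) * sqnorm (\<lambda>x. u x - g x))"
    using lam by (intro ennreal_mult[symmetric] sqnorm_nonneg) simp
  ultimately show ?thesis
    unfolding energy_eq Lnorm_sqnorm[OF L2_diff[OF u g]] using R by (simp only: ennreal_plus if_True)
qed

lemma integrable_K_times:
  assumes h: "integrable LS h"
  shows "integrable LS (\<lambda>z. K z * h z)"
proof -
  obtain B where B: "\<And>z. z \<in> Omega \<times> Omega \<Longrightarrow> \<bar>K z\<bar> \<le> B"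
    using K_bdd unfolding bounded_iff by auto
  show ?thesis
  proof (rule Bochner_Integration.integrable_bound)
    show "integrable LS (\<lambda>z. B * h z)" using h by (rule integrable_mult_right)
    have "norm (K z * h z) \<le> norm (B * h z)" if "z \<in> Omega \<times> Omega" for z
      using B[OF that] by (simp add: abs_mult mult_right_mono)
    then show "AE z in LS. norm (K z * h z) \<le> norm (B * h z)"
      by (intro AE_I2) simp
  qed (intro borel_measurable_times K_meas borel_measurable_integrable[OF h])
qed

lemma integrable_incr_inj1: "integrable LS (incr p (inj1 n v))"
proof (rule LS.integrable_const_bound)
  let ?B = "\<Sum>i=1..n. \<bar>v i\<bar>"
  have "norm (incr p (inj1 n v) z) \<le> (2 * ?B) powr p" for z
  proof -
    have "\<bar>inj1 n v (snd z) - inj1 n v (fst z)\<bar> \<le> 2 * ?B"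
      using inj1_bounded[of n v "fst z"] inj1_bounded[of n v "snd z"] by linarith
    then show ?thesis
      using p powr_mono2[of p "\<bar>inj1 n v (snd z) - inj1 n v (fst z)\<bar>" "2 * ?B"] by (simp add: incr_def)
  qed
  then show "AE z in LS. norm (incr p (inj1 n v) z) \<le> (2 * ?B) powr p" by simp
qed (rule measurable_incr[OF measurable_inj1])

lemma finite_R_inj1: "finite_R (inj1 n v)"
  unfolding finite_R_def by (rule integrable_K_times[OF integrable_incr_inj1])

lemma minimizer_D:
  assumes min: "minimizer p lam g K u"
  shows "u \<in> L2" and "finite_R u"
    and "v \<in> L2 \<Longrightarrow> finite_R v \<Longrightarrow>
      sqnorm (\<lambda>x. u x - g x) + lam / p * R u \<le> sqnorm (\<lambda>x. v x - g x) + lam / p * R v"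
proof -
  have le: "energy p lam u g K \<le> energy p lam v g K" if "v \<in> L2" for v
    using min that unfolding minimizer_def is_arg_min_def by (meson not_less)
  show u: "u \<in> L2" using min by (simp add: minimizer_def is_arg_min_def)
  \<comment> \<open>The competitor is the zero function, written as an injected vector so that the
    facts about \<open>inj1\<close> show its energy to be finite.\<close>
  have "energy p lam u g K \<le> energy p lam (inj1 1 (\<lambda>_. 0)) g K"
    by (rule le[OF inj1_in_L2])
  also have "\<dots> < \<infinity>"
    unfolding energy_finite[OF inj1_in_L2 finite_R_inj1] by simp
  finally show R: "finite_R u"
    unfolding energy_eq by (auto split: if_splits)
  assume v: "v \<in> L2" "finite_R v"
  have nonneg: "0 \<le> 1 / (2 * lam) * sqnorm (\<lambda>x. v x - g x) + 1 / (2 * p) * R v"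
    using lam p sqnorm_nonneg R_nonneg by simp
  have "1 / (2 * lam) * sqnorm (\<lambda>x. u x - g x) + 1 / (2 * p) * R u
      \<le> 1 / (2 * lam) * sqnorm (\<lambda>x. v x - g x) + 1 / (2 * p) * R v"
    using le[OF v(1)] nonneg unfolding energy_finite[OF u R] energy_finite[OF v]
    by (simp only: ennreal_le_iff)
  from mult_left_mono[OF this, of "2 * lam"]
  have le2: "2 * lam * (1 / (2 * lam) * sqnorm (\<lambda>x. u x - g x) + 1 / (2 * p) * R u)
      \<le> 2 * lam * (1 / (2 * lam) * sqnorm (\<lambda>x. v x - g x) + 1 / (2 * p) * R v)"
    using lam by simp
  have scale: "2 * lam * (1 / (2 * lam) * a + 1 / (2 * p) * b) = a + lam / p * b" for a b
    using lam p by (simp add: field_simps)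
  from le2 show
    "sqnorm (\<lambda>x. u x - g x) + lam / p * R u \<le> sqnorm (\<lambda>x. v x - g x) + lam / p * R v"
    unfolding scale .
qed

text \<open>The quadratic fidelity term makes the energy strongly convex; the estimate follows by comparing
  the minimum with the energy on the segment from \<open>u\<close> to \<open>w\<close> near \<open>u\<close>.\<close>
lemma strong_convexity:
  assumes min: "minimizer p lam g K u" and w: "w \<in> L2" "finite_R w"
  shows "sqnorm (\<lambda>x. w x - u x)
    \<le> sqnorm (\<lambda>x. w x - g x) - sqnorm (\<lambda>x. u x - g x) + lam / p * (R w - R u)"
    (is "_ \<le> ?X")
\<comment> \<open>It suffices to prove the bound with an extra factor s on the left for every s in
  (0,1). This takes the place of the limit s to 1 and leaves 1 - s > 0 to be cancelled.\<close>
proof (rule field_le_mult_one_interval)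
  note u = minimizer_D(1,2)[OF min]
  fix s :: real assume s: "0 < s" "s < 1"
  define c where "c = lam / p"
  define v where "v = (\<lambda>x. s * u x + (1 - s) * w x)"
  have v: "v \<in> L2" unfolding v_def by (rule L2_combination[OF u(1) w(1)])
  have int: "integrable LS (\<lambda>z. s * (K z * incr p u z) + (1 - s) * (K z * incr p w z))"
    using u(2) w(2) unfolding finite_R_def
    by (intro Bochner_Integration.integrable_add integrable_mult_right)
  have incr: "incr p v z \<le> s * incr p u z + (1 - s) * incr p w z" for z
  proof -
    have "v (snd z) - v (fst z) = (1 - (1 - s)) *\<^sub>R (u (snd z) - u (fst z)) + (1 - s) *\<^sub>R (w (snd z) - w (fst z))"
      by (simp add: v_def algebra_simps)
    then show ?thesis
      using convex_onD[OF convex_on_abs_powr[OF p], of "1 - s" "u (snd z) - u (fst z)" "w (snd z) - w (fst z)"] s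
      by (simp add: incr_def)
  qed
  have K_incr: "K z * incr p v z \<le> s * (K z * incr p u z) + (1 - s) * (K z * incr p w z)"
    if "0 \<le> K z" for z
    using mult_left_mono[OF incr that, of z] by (simp add: algebra_simps)
  have Rv: "finite_R v"
    unfolding finite_R_def
  proof (rule Bochner_Integration.integrable_bound[OF int])
    show "AE z in LS. norm (K z * incr p v z)
        \<le> norm (s * (K z * incr p u z) + (1 - s) * (K z * incr p w z))"
      using AE_K_nonneg
    proof eventually_elim
      case (elim z)
      then have "0 \<le> K z * incr p v z" by (simp add: incr_nonneg)
      then show ?case using K_incr[OF elim] by simp
    qed
  qed (intro borel_measurable_times K_meas measurable_incr L2_D v)
  have ae: "AE z in LS. K z * incr p v z \<le> s * (K z * incr p u z) + (1 - s) * (K z * incr p w z)"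
    using AE_K_nonneg by eventually_elim (rule K_incr)
  have "R v \<le> (LINT z|LS. s * (K z * incr p u z) + (1 - s) * (K z * incr p w z))"
    unfolding R_def
    by (rule integral_mono_AE[OF Rv[unfolded finite_R_def] int ae])
  also have "\<dots> = s * R u + (1 - s) * R w"
    unfolding R_def using u(2) w(2) unfolding finite_R_def by simp
  finally have Rle: "R v \<le> s * R u + (1 - s) * R w" .
  have i: "integrable LI (\<lambda>x. (u x - g x)\<^sup>2)" "integrable LI (\<lambda>x. (w x - g x)\<^sup>2)"
      "integrable LI (\<lambda>x. (w x - u x)\<^sup>2)"
    by (rule L2_D(2); intro L2_diff u w g)+
  \<comment> \<open>For the quadratic term convexity is an identity; its defect s (1 - s) times the
    squared distance of w and u is the quantity to be estimated.\<close>
  have "sqnorm (\<lambda>x. v x - g x)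
      = (LINT x|LI. s * (u x - g x)\<^sup>2 + (1 - s) * (w x - g x)\<^sup>2 - s * (1 - s) * (w x - u x)\<^sup>2)"
    unfolding sqnorm_def v_def
    by (rule Bochner_Integration.integral_cong) (simp_all add: power2_eq_square algebra_simps)
  also have "\<dots> = s * sqnorm (\<lambda>x. u x - g x) + (1 - s) * sqnorm (\<lambda>x. w x - g x)
      - s * (1 - s) * sqnorm (\<lambda>x. w x - u x)"
    unfolding sqnorm_def using i by simp
  finally have "sqnorm (\<lambda>x. u x - g x) + lam / p * R u
      \<le> s * sqnorm (\<lambda>x. u x - g x) + (1 - s) * sqnorm (\<lambda>x. w x - g x)
        - s * (1 - s) * sqnorm (\<lambda>x. w x - u x) + lam / p * R v"
    using minimizer_D(3)[OF min v Rv] by simp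
  also have "lam / p * R v \<le> lam / p * (s * R u + (1 - s) * R w)"
    using Rle lam p by (intro mult_left_mono) auto
  finally have "sqnorm (\<lambda>x. u x - g x) + lam / p * R u
      \<le> s * sqnorm (\<lambda>x. u x - g x) + (1 - s) * sqnorm (\<lambda>x. w x - g x)
        - s * (1 - s) * sqnorm (\<lambda>x. w x - u x) + lam / p * (s * R u + (1 - s) * R w)"
    by simp
  then have "(1 - s) * (s * sqnorm (\<lambda>x. w x - u x)) \<le> (1 - s) * ?X"
    unfolding c_def[symmetric] by (simp add: algebra_simps)
  then show "s * sqnorm (\<lambda>x. w x - u x) \<le> ?X"
    using s by simp
qed

section \<open>Comparison of the discrete and the continuous energy\<close>

lemma integral_cell_mult_left:
  "(LINT z:cell n i \<times> cell n j|LS. K z * a) = proj2 n K i j / (real n)\<^sup>2 * a"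
  if "i \<in> {1..n}" "j \<in> {1..n}" for a
  unfolding set_integral_mult_left proj2_LS[OF that] ..

text \<open>The increment of \<open>inj1 n v\<close> is constant on a product of cells, so K enters
  only through its cell integral.\<close>

lemma R_inj1:
  assumes n: "n \<ge> 1"
  shows "R (inj1 n v) = (\<Sum>i=1..n. \<Sum>j=1..n. proj2 n K i j / (real n)\<^sup>2 * \<bar>v j - v i\<bar> powr p)"
  unfolding R_def integral_cells2[OF n finite_R_inj1[unfolded finite_R_def]]
proof (intro sum.cong refl)
  fix i j assume ij: "i \<in> {1..n}" "j \<in> {1..n}"
  have "(LINT z:cell n i \<times> cell n j|LS. K z * incr p (inj1 n v) z)
      = (LINT z:cell n i \<times> cell n j|LS. K z * \<bar>v j - v i\<bar> powr p)"
    by (rule set_lebesgue_integral_cong[OF measure_cell_Times(1)[OF ij]])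
       (auto simp: incr_def inj1_cell[OF ij(1)] inj1_cell[OF ij(2)])
  then show "(LINT z:cell n i \<times> cell n j|LS. K z * incr p (inj1 n v) z)
      = proj2 n K i j / (real n)\<^sup>2 * \<bar>v j - v i\<bar> powr p"
    unfolding integral_cell_mult_left[OF ij] .
qed

lemma discrete_energy_eq:
  assumes n: "n \<ge> 1"
  shows "discrete_energy p n lam v (proj1 n g) (proj2 n K) =
    1 / (2 * lam) * (sqnorm (\<lambda>x. inj1 n v x - g x) - sqnorm (\<lambda>x. g x - inj1 n (proj1 n g) x)
      + lam / p * R (inj1 n v))"
proof -
  have "R (inj1 n v) = (\<Sum>i=1..n. \<Sum>j=1..n. proj2 n K i j * \<bar>v j - v i\<bar> powr p) / (real n)\<^sup>2"
    unfolding R_inj1[OF n] by (simp add: sum_divide_distrib)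
  then show ?thesis
    unfolding discrete_energy_def sqnorm_inj1_diff[OF n g] using lam p n
    by (simp add: field_simps)
qed

lemma discrete_minimizer_D:
  assumes n: "n \<ge> 1" and min: "discrete_minimizer p n lam g K un"
  shows "sqnorm (\<lambda>x. inj1 n un x - g x) + lam / p * R (inj1 n un)
    \<le> sqnorm (\<lambda>x. inj1 n v x - g x) + lam / p * R (inj1 n v)"
proof -
  have "discrete_energy p n lam un (proj1 n g) (proj2 n K)
      \<le> discrete_energy p n lam v (proj1 n g) (proj2 n K)"
    using min by (auto simp: discrete_minimizer_def is_arg_min_def not_less)
  then show ?thesis
    unfolding discrete_energy_eq[OF n] using lam by (simp add: divide_le_cancel)
qed

lemma proj2_nonneg:
  assumes "i \<in> {1..n}" "j \<in> {1..n}"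
  shows "0 \<le> proj2 n K i j"
proof -
  have "0 \<le> (LINT z:cell n i \<times> cell n j|LS. K z)"
    unfolding set_lebesgue_integral_def
    by (rule integral_nonneg_AE) (use AE_K_nonneg in \<open>eventually_elim, simp\<close>)
  moreover have "real n > 0" using assms by simp
  ultimately show ?thesis unfolding proj2_LS[OF assms] by (simp add: zero_le_divide_iff)
qed

lemma integrable_inj2_times:
  assumes h: "integrable LS h"
  shows "integrable LS (\<lambda>z. inj2 n F z * h z)"
proof (rule Bochner_Integration.integrable_bound)
  let ?B = "\<Sum>i=1..n. \<Sum>j=1..n. \<bar>F i j\<bar>"
  show "integrable LS (\<lambda>z. ?B * h z)" using h by (rule integrable_mult_right)
  have "norm (inj2 n F z * h z) \<le> norm (?B * h z)" for z
    using inj2_bounded[of n F z] by (simp add: abs_mult mult_right_mono)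
  then show "AE z in LS. norm (inj2 n F z * h z) \<le> norm (?B * h z)" by simp
qed (intro borel_measurable_times measurable_inj2 borel_measurable_integrable[OF h])

text \<open>Jensen's inequality on each product of cells, multiplied by the nonnegative entry of
  \<open>proj2 n K\<close>. That entry may then be moved under the integral, where it is the value
  of \<open>inj2 n (proj2 n K)\<close>.\<close>

lemma R_inj1_proj1_le:
  assumes n: "n \<ge> 1" and u: "integrable LI u" and W: "integrable LS (incr p u)"
  shows "R (inj1 n (proj1 n u)) \<le> (LINT z|LS. inj2 n (proj2 n K) z * incr p u z)"
  unfolding R_inj1[OF n] integral_cells2[OF n integrable_inj2_times[OF W]]
proof (intro sum_mono)
  fix i j assume ij: "i \<in> {1..n}" "j \<in> {1..n}"
  have "proj2 n K i j / (real n)\<^sup>2 * \<bar>proj1 n u j - proj1 n u i\<bar> powr p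
      \<le> proj2 n K i j * (LINT z:cell n i \<times> cell n j|LS. incr p u z)"
    using mult_left_mono[OF proj1_incr_le[OF ij p u W] proj2_nonneg[OF ij]] by simp
  also have "\<dots> = (LINT z:cell n i \<times> cell n j|LS. proj2 n K i j * incr p u z)"
    by simp
  also have "\<dots> = (LINT z:cell n i \<times> cell n j|LS. inj2 n (proj2 n K) z * incr p u z)"
    by (rule set_lebesgue_integral_cong[OF measure_cell_Times(1)[OF ij]])
       (auto simp: inj2_cell[OF ij])
  finally show "proj2 n K i j / (real n)\<^sup>2 * \<bar>proj1 n u j - proj1 n u i\<bar> powr p
      \<le> (LINT z:cell n i \<times> cell n j|LS. inj2 n (proj2 n K) z * incr p u z)" .
qed

text \<open>\<open>finite_R u\<close> controls the increments only weighted by K, while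
  \<open>inj2 n (proj2 n K)\<close> may be positive where K vanishes. Hence the assumption W, which
  the two parts of the theorem supply differently: from p \<le> 2, or from a positive lower bound on
  K.\<close>

lemma error_estimate:
  assumes n: "n \<ge> 1" and min: "minimizer p lam g K u" and dmin: "discrete_minimizer p n lam g K un"
    and W: "integrable LS (incr p u)"
  shows "sqnorm (\<lambda>x. inj1 n un x - u x) \<le> sqnorm (\<lambda>x. g x - inj1 n (proj1 n g) x)
    + lam / p * (LINT z|LS. \<bar>K z - inj2 n (proj2 n K) z\<bar> * \<bar>incr p u z\<bar>)"
proof -
  note u = minimizer_D(1,2)[OF min]
  let ?I = "inj2 n (proj2 n K)" and ?P = "inj1 n (proj1 n u)"
  have iK: "integrable LS (\<lambda>z. K z * incr p u z)" by (rule integrable_K_times[OF W])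
  have iI: "integrable LS (\<lambda>z. ?I z * incr p u z)" by (rule integrable_inj2_times[OF W])
  have "integrable LS (\<lambda>z. \<bar>K z * incr p u z - ?I z * incr p u z\<bar>)"
    by (intro integrable_abs Bochner_Integration.integrable_diff iK iI)
  moreover have eq: "\<bar>K z * incr p u z - ?I z * incr p u z\<bar> = \<bar>K z - ?I z\<bar> * \<bar>incr p u z\<bar>" for z
    by (simp add: abs_mult[symmetric] left_diff_distrib)
  ultimately have iD: "integrable LS (\<lambda>z. \<bar>K z - ?I z\<bar> * \<bar>incr p u z\<bar>)" by simp
  have "(LINT z|LS. ?I z * incr p u z) - R u = (LINT z|LS. ?I z * incr p u z - K z * incr p u z)"
    unfolding R_def using iI iK by simp
  also have "\<dots> \<le> (LINT z|LS. \<bar>K z - ?I z\<bar> * \<bar>incr p u z\<bar>)"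
    by (rule integral_mono[OF Bochner_Integration.integrable_diff[OF iI iK] iD]) (simp only: eq[symmetric])
  finally have "R ?P - R u \<le> (LINT z|LS. \<bar>K z - ?I z\<bar> * \<bar>incr p u z\<bar>)"
    using R_inj1_proj1_le[OF n L2_integrable[OF u(1)] W] by linarith
  then have "lam / p * (R ?P - R u) \<le> lam / p * (LINT z|LS. \<bar>K z - ?I z\<bar> * \<bar>incr p u z\<bar>)"
    using lam p by (intro mult_left_mono) auto
  \<comment> \<open>The energy of \<open>inj1 n un\<close> is replaced by that of
    \<open>inj1 n (proj1 n u)\<close>, whose fidelity exceeds that of u by at most the error of g;
    the fidelity of u then cancels.\<close>
  then show ?thesis
    using strong_convexity[OF min inj1_in_L2 finite_R_inj1, of n un] discrete_minimizer_D[OF n dmin, of "proj1 n u"]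
      sqnorm_inj1_proj1_diff_le[OF n u(1) g]
    by (simp add: right_diff_distrib)
qed

text \<open>The zero function has scaled energy \<open>sqnorm g\<close>. The factor 4 comes from
  applying (a + b)^2 \<le> 2 a^2 + 2 b^2 to u = (u - g) + g.\<close>

lemma a_priori_bounds:
  assumes min: "minimizer p lam g K u"
  shows "lam / p * R u \<le> sqnorm g" and "sqnorm u \<le> 4 * sqnorm g"
proof -
  note u = minimizer_D(1,2)[OF min]
  have "R (inj1 1 (\<lambda>_. 0)) = 0" using R_inj1[of 1 "\<lambda>_. 0"] by simp
  then have le: "sqnorm (\<lambda>x. u x - g x) + lam / p * R u \<le> sqnorm g"
    using minimizer_D(3)[OF min inj1_in_L2 finite_R_inj1, of 1 "\<lambda>_. 0"]
    by (simp add: sqnorm_def inj1_def)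
  then show "lam / p * R u \<le> sqnorm g"
    using sqnorm_nonneg[of "\<lambda>x. u x - g x"] by linarith
  have "0 \<le> lam / p * R u" using lam p R_nonneg by simp
  moreover have "sqnorm u \<le> 2 * sqnorm (\<lambda>x. u x - g x) + 2 * sqnorm g"
    using sqnorm_sum_le[OF L2_diff[OF u(1) g] g] by simp
  ultimately show "sqnorm u \<le> 4 * sqnorm g" using le by linarith
qed

section \<open>Size of the kernel discretisation error\<close>

lemma kernel_error:
  defines "d n z \<equiv> K z - inj2 n (proj2 n K) z"
  shows "d n \<in> borel_measurable LS"
    and "\<exists>c. \<forall>z \<in> Omega \<times> Omega. \<bar>d n z\<bar> \<le> c"
proof -
  show "d n \<in> borel_measurable LS"
    unfolding d_def by (intro borel_measurable_diff K_meas measurable_inj2)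
  obtain B where B: "\<And>z. z \<in> Omega \<times> Omega \<Longrightarrow> \<bar>K z\<bar> \<le> B"
    using K_bdd unfolding bounded_iff by auto
  show "\<exists>c. \<forall>z \<in> Omega \<times> Omega. \<bar>d n z\<bar> \<le> c"
  proof (intro exI ballI)
    fix z assume "z \<in> Omega \<times> Omega"
    from B[OF this] inj2_bounded[of n "proj2 n K" z]
    show "\<bar>d n z\<bar> \<le> B + (\<Sum>i=1..n. \<Sum>j=1..n. \<bar>proj2 n K i j\<bar>)"
      unfolding d_def by linarith
  qed
qed

lemma Lnorm_infinity_kernel_error:
  "Lnorm LS \<infinity> (\<lambda>z. K z - inj2 n (proj2 n K) z) < \<infinity>"
proof -
  obtain c where c: "\<And>z. z \<in> Omega \<times> Omega \<Longrightarrow> \<bar>K z - inj2 n (proj2 n K) z\<bar> \<le> c"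
    using kernel_error(2)[of n] by blast
  have m: "(\<lambda>z. ennreal \<bar>K z - inj2 n (proj2 n K) z\<bar>) \<in> borel_measurable LS"
    using kernel_error(1) by (intro measurable_compose[OF _ measurable_ennreal] borel_measurable_abs)
  have "AE z in LS. ennreal \<bar>K z - inj2 n (proj2 n K) z\<bar> \<le> ennreal c"
    using c by (intro AE_I2 ennreal_leI) simp
  from esssup_I[OF m this] show ?thesis
    unfolding Lnorm_def by (simp add: le_less_trans[OF _ ennreal_less_top])
qed

text \<open>Hoelder with exponents 2/(2-p) and 2/p, which degenerate to infinity and 1 for p = 2.
  The norm is delivered as a real number e for use in real inequalities.\<close>

lemma Hoelder_kernel_error:
  assumes p2: "p \<le> 2" and u: "u \<in> L2"
  defines "d n z \<equiv> K z - inj2 n (proj2 n K) z"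
  obtains e where "e \<ge> 0" "Lnorm LS (2 / ennreal (2 - p)) (d n) = ennreal e"
    "(LINT z|LS. \<bar>d n z\<bar> * \<bar>incr p u z\<bar>) \<le> (1 + 4 * sqnorm u) * e"
proof (cases "p = 2")
  case True
  define e where "e = enn2real (Lnorm LS \<infinity> (d n))"
  have fin: "Lnorm LS \<infinity> (d n) < \<infinity>"
    unfolding d_def by (rule Lnorm_infinity_kernel_error)
  have dm: "d n \<in> borel_measurable LS" unfolding d_def by (rule kernel_error(1))
  have e: "e \<ge> 0" by (simp add: e_def)
  have int: "(LINT z|LS. \<bar>incr p u z\<bar>) \<le> 1 + 4 * sqnorm u"
    using integral_incr_2(2)[OF u] True by (simp add: incr_nonneg)
  have "(LINT z|LS. \<bar>d n z\<bar> * \<bar>incr p u z\<bar>) \<le> e * (LINT z|LS. \<bar>incr p u z\<bar>)"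
    unfolding e_def by (rule L_infinity_bound(2)[OF dm fin integrable_incr_L2[OF u p p2]])
  also have "\<dots> \<le> (1 + 4 * sqnorm u) * e"
    using mult_left_mono[OF int e] by (simp only: mult.commute)
  finally show ?thesis
  proof (rule that[OF e, rotated])
    have "2 / ennreal (2 - p) = \<infinity>" using True by (simp add: ennreal_divide_zero)
    then show "Lnorm LS (2 / ennreal (2 - p)) (d n) = ennreal e"
      using fin by (simp add: e_def)
  qed
next
  case False
  with p2 have p2: "p < 2" by simp
  define r where "r = 2 / (2 - p)"
  define s where "s = 2 / p"
  have rs: "r > 1" "s > 1" "1 / r + 1 / s = 1"
    using p p2 by (simp_all add: r_def s_def field_simps)
  obtain c where c: "\<And>z. z \<in> Omega \<times> Omega \<Longrightarrow> \<bar>d n z\<bar> \<le> c"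
    using kernel_error(2)[of n] unfolding d_def by blast
  have dm: "d n \<in> borel_measurable LS" unfolding d_def by (rule kernel_error(1))
  have idr: "integrable LS (\<lambda>z. \<bar>d n z\<bar> powr r)"
  proof (rule LS.integrable_const_bound)
    have "norm (\<bar>d n z\<bar> powr r) \<le> c powr r" if "z \<in> Omega \<times> Omega" for z
      using powr_mono2[OF _ abs_ge_zero c[OF that], of r] rs by simp
    then show "AE z in LS. norm (\<bar>d n z\<bar> powr r) \<le> c powr r"
      by (intro AE_I2) simp
    have "(\<lambda>x::real. \<bar>x\<bar> powr r) \<in> borel_measurable borel" by measurable
    then show "(\<lambda>z. \<bar>d n z\<bar> powr r) \<in> borel_measurable LS" by (rule measurable_compose[OF dm])
  qed
  \<comment> \<open>The reason for s = 2/p: the second factor becomes the integral of squared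
    increments.\<close>
  have W: "\<bar>incr p u z\<bar> powr s = incr 2 u z" for z
    using p by (simp add: incr_def s_def powr_powr)
  define e where "e = (LINT z|LS. \<bar>d n z\<bar> powr r) powr (1 / r)"
  have e: "e \<ge> 0" by (simp add: e_def)
  have Le: "Lnorm LS (2 / ennreal (2 - p)) (d n) = ennreal e"
  proof -
    have "2 / ennreal (2 - p) = ennreal r"
      unfolding r_def using p2 divide_ennreal[of 2 "2 - p"] by simp
    then show ?thesis
      unfolding e_def using Lnorm_eq[OF _ idr] rs by simp
  qed
  \<comment> \<open>Removes the fractional power p/2 \<le> 1, so that the bound is affine in
    \<open>sqnorm u\<close> and free of p.\<close>
  have le: "y powr (1 / s) \<le> 1 + y" if "y \<ge> 0" for y :: real
  proof (cases "y \<le> 1")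
    case True
    then have "y powr (1 / s) \<le> 1" using powr_mono2[of "1 / s" y 1] rs that by simp
    then show ?thesis using that by simp
  next
    case False
    then have "y powr (1 / s) \<le> y powr 1" using rs by (intro powr_mono) auto
    then show ?thesis using False by simp
  qed
  have "(LINT z|LS. incr 2 u z) powr (1 / s) \<le> 1 + (LINT z|LS. incr 2 u z)"
    by (rule le) (simp add: incr_nonneg)
  then have int: "(LINT z|LS. incr 2 u z) powr (1 / s) \<le> 1 + 4 * sqnorm u"
    using integral_incr_2(2)[OF u] by linarith
  have "(LINT z|LS. \<bar>d n z\<bar> * \<bar>incr p u z\<bar>) \<le> e * (LINT z|LS. incr 2 u z) powr (1 / s)"
    using Hoelder(2)[OF rs dm idr measurable_incr[OF L2_D(1)[OF u]], of p] integral_incr_2(1)[OF u]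
    unfolding W e_def by blast
  also have "\<dots> \<le> (1 + 4 * sqnorm u) * e"
    using mult_left_mono[OF int e] by (simp only: mult.commute)
  finally show ?thesis by (rule that[OF e Le])
qed

text \<open>Replaces the domination by squares, which is confined to p \<le> 2: the finite
  regularizer dominates the increments directly.\<close>

lemma integrable_incr_coercive:
  assumes kap: "\<kappa> > 0" and K: "\<And>z. z \<in> Omega \<times> Omega \<Longrightarrow> \<kappa> \<le> K z"
    and u: "u \<in> L2" "finite_R u"
  shows "integrable LS (incr p u)" and "\<kappa> * (LINT z|LS. \<bar>incr p u z\<bar>) \<le> R u"
proof -
  have le: "\<kappa> * incr p u z \<le> K z * incr p u z" if "z \<in> Omega \<times> Omega" for z
    by (intro mult_right_mono K that incr_nonneg)
  have int: "integrable LS (\<lambda>z. \<kappa> * incr p u z)"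
  proof (rule Bochner_Integration.integrable_bound[OF u(2)[unfolded finite_R_def]])
    have "norm (\<kappa> * incr p u z) \<le> norm (K z * incr p u z)" if "z \<in> Omega \<times> Omega" for z
      using le[OF that] kap incr_nonneg[of p u z] by simp
    then show "AE z in LS. norm (\<kappa> * incr p u z) \<le> norm (K z * incr p u z)"
      by (intro AE_I2) simp
  qed (intro borel_measurable_times borel_measurable_const measurable_incr L2_D u)
  then show W: "integrable LS (incr p u)" using kap by simp
  have "\<kappa> * (LINT z|LS. \<bar>incr p u z\<bar>) = (LINT z|LS. \<kappa> * incr p u z)"
    by (simp add: incr_nonneg)
  also have "\<dots> \<le> R u"
    unfolding R_def by (rule integral_mono[OF int u(2)[unfolded finite_R_def]]) (simp add: le)
  finally show "\<kappa> * (LINT z|LS. \<bar>incr p u z\<bar>) \<le> R u" .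
qed

text \<open>The constant is 1 + 4 \<open>sqnorm u\<close> with the a priori bound inserted; the
  factor lam/p is at most lam because p \<ge> 1.\<close>

lemma error_bound_p_le_2:
  assumes p2: "p \<le> 2" and n: "n \<ge> 1"
    and min: "minimizer p lam g K u" and dmin: "discrete_minimizer p n lam g K un"
  shows "\<exists>e\<ge>0. Lnorm LS (2 / ennreal (2 - p)) (\<lambda>z. K z - inj2 n (proj2 n K) z) = ennreal e
    \<and> sqnorm (\<lambda>x. inj1 n un x - u x)
      \<le> (1 + 16 * sqnorm g) * (sqnorm (\<lambda>x. g x - inj1 n (proj1 n g) x) + lam * e)"
proof -
  note u = minimizer_D(1,2)[OF min]
  let ?d = "\<lambda>z. K z - inj2 n (proj2 n K) z" and ?G = "sqnorm (\<lambda>x. g x - inj1 n (proj1 n g) x)"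
  obtain e where e: "e \<ge> 0" "Lnorm LS (2 / ennreal (2 - p)) ?d = ennreal e"
    "(LINT z|LS. \<bar>?d z\<bar> * \<bar>incr p u z\<bar>) \<le> (1 + 4 * sqnorm u) * e"
    using Hoelder_kernel_error[OF p2 u(1), of n] by blast
  have M: "1 + 4 * sqnorm u \<le> 1 + 16 * sqnorm g" "1 \<le> 1 + 16 * sqnorm g"
    using a_priori_bounds(2)[OF min] sqnorm_nonneg[of g] by simp_all
  have lp: "lam / p \<le> lam" "0 \<le> lam / p" using lam p by (simp_all add: divide_le_eq)
  have "sqnorm (\<lambda>x. inj1 n un x - u x) \<le> ?G + lam / p * (LINT z|LS. \<bar>?d z\<bar> * \<bar>incr p u z\<bar>)"
    by (rule error_estimate[OF n min dmin integrable_incr_L2[OF u(1) p p2]])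
  also have "\<dots> \<le> ?G + lam * ((1 + 16 * sqnorm g) * e)"
  proof (rule add_left_mono, rule mult_mono)
    have "(1 + 4 * sqnorm u) * e \<le> (1 + 16 * sqnorm g) * e" by (rule mult_right_mono[OF M(1) e(1)])
    with e(3) show "(LINT z|LS. \<bar>?d z\<bar> * \<bar>incr p u z\<bar>) \<le> (1 + 16 * sqnorm g) * e" by (rule order.trans)
  qed (use lp lam in auto)
  also have "\<dots> \<le> (1 + 16 * sqnorm g) * ?G + lam * ((1 + 16 * sqnorm g) * e)"
    using mult_right_mono[OF M(2) sqnorm_nonneg[of "\<lambda>x. g x - inj1 n (proj1 n g) x"]] by simp
  also have "\<dots> = (1 + 16 * sqnorm g) * (?G + lam * e)" by (simp add: algebra_simps)
  finally show ?thesis using e by blast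
qed

text \<open>The a priori bound on \<open>lam / p * R u\<close> absorbs the factor lam/p in front of
  the kernel term, so neither lam nor p appears in the constant.\<close>

lemma error_bound_coercive:
  assumes kap: "\<kappa> > 0" and K: "\<And>z. z \<in> Omega \<times> Omega \<Longrightarrow> \<kappa> \<le> K z" and n: "n \<ge> 1"
    and min: "minimizer p lam g K u" and dmin: "discrete_minimizer p n lam g K un"
  shows "\<exists>e\<ge>0. Lnorm LS \<infinity> (\<lambda>z. K z - inj2 n (proj2 n K) z) = ennreal e
    \<and> sqnorm (\<lambda>x. inj1 n un x - u x)
      \<le> (1 + sqnorm g / \<kappa>) * (sqnorm (\<lambda>x. g x - inj1 n (proj1 n g) x) + e)"
proof -
  note u = minimizer_D(1,2)[OF min]
  let ?d = "\<lambda>z. K z - inj2 n (proj2 n K) z" and ?G = "sqnorm (\<lambda>x. g x - inj1 n (proj1 n g) x)"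
  let ?W = "LINT z|LS. \<bar>incr p u z\<bar>"
  define e where "e = enn2real (Lnorm LS \<infinity> ?d)"
  have e: "e \<ge> 0" "Lnorm LS \<infinity> ?d = ennreal e"
    using Lnorm_infinity_kernel_error[of n] by (simp_all add: e_def)
  note W = integrable_incr_coercive[OF kap K u]
  have lp: "0 \<le> lam / p" using lam p by simp
  have "\<kappa> * (lam / p * ?W) = lam / p * (\<kappa> * ?W)" by simp
  also have "\<dots> \<le> lam / p * R u" by (rule mult_left_mono[OF W(2) lp])
  also have "\<dots> \<le> sqnorm g" by (rule a_priori_bounds(1)[OF min])
  finally have Wg: "lam / p * ?W \<le> sqnorm g / \<kappa>"
    using kap by (simp add: le_divide_eq mult.commute)
  have "sqnorm (\<lambda>x. inj1 n un x - u x) \<le> ?G + lam / p * (LINT z|LS. \<bar>?d z\<bar> * \<bar>incr p u z\<bar>)"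
    by (rule error_estimate[OF n min dmin W(1)])
  also have "\<dots> \<le> ?G + lam / p * (e * ?W)"
    unfolding e_def
    by (intro add_left_mono mult_left_mono lp
        L_infinity_bound(2)[OF kernel_error(1) Lnorm_infinity_kernel_error W(1)])
  also have "\<dots> \<le> ?G + sqnorm g / \<kappa> * e"
    using mult_right_mono[OF Wg e(1)] by (simp add: mult_ac)
  also have "\<dots> \<le> (1 + sqnorm g / \<kappa>) * (?G + e)"
    using kap e(1) sqnorm_nonneg[of g] sqnorm_nonneg[of "\<lambda>x. g x - inj1 n (proj1 n g) x"]
    by (simp add: distrib_right distrib_left)
  finally show ?thesis using e by blast
qed

end

text \<open>Here x and y stand for the unsquared error of g and the term in u. They range over
  \<open>ennreal\<close> and may be infinite.\<close>

lemma ennreal_bound_with_slack: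
  assumes "a \<le> C * (b + c)" "b \<ge> 0" "c \<ge> 0" "C \<ge> 0"
  shows "ennreal a \<le> ennreal C * (ennreal b + x + ennreal c + y)"
proof -
  have "ennreal a \<le> ennreal (C * (b + c))" using assms by (intro ennreal_leI)
  also have "\<dots> = ennreal C * (ennreal b + ennreal c)" using assms by (simp add: ennreal_mult)
  also have "\<dots> \<le> ennreal C * (ennreal b + x + ennreal c + y)"
    by (intro mult_left_mono) (simp_all add: add_increasing2 add_right_mono)
  finally show ?thesis .
qed

theorem theorem4p1:
  fixes g :: "real \<Rightarrow> real" and K :: "real \<times> real \<Rightarrow> real"
  assumes g: "g \<in> L2"
    and K_nonneg: "\<forall>z \<in> Omega \<times> Omega. K z \<ge> 0"
    and K_meas: "K \<in> borel_measurable (lebesgue_on (Omega \<times> Omega))"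
    and K_sym: "\<forall>x \<in> Omega. \<forall>y \<in> Omega. K (x, y) = K (y, x)"
    and K_bdd: "bounded (K ` (Omega \<times> Omega))"
  shows
    "(\<forall>p \<in> {1..2::real}. \<exists>C>0::real. \<forall>lam>0::real. \<forall>n\<ge>1::nat. \<forall>u un.
        minimizer p lam g K u \<longrightarrow> discrete_minimizer p n lam g K un \<longrightarrow>
        (Lnorm (lebesgue_on Omega) 2 (\<lambda>x. inj1 n un x - u x))\<^sup>2
        \<le> ennreal C *
           ((Lnorm (lebesgue_on Omega) 2 (\<lambda>x. g x - inj1 n (proj1 n g) x))\<^sup>2
            + Lnorm (lebesgue_on Omega) 2 (\<lambda>x. g x - inj1 n (proj1 n g) x)
            + ennreal lam * Lnorm (lebesgue_on (Omega \<times> Omega)) (2 / ennreal (2 - p))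
                (\<lambda>z. K z - inj2 n (proj2 n K) z)
            + ennreal lam * Lnorm (lebesgue_on Omega) (2 / ennreal (3 - p))
                (\<lambda>x. u x - inj1 n (proj1 n u) x)))
     \<and>
     (\<forall>\<kappa>>0::real. (INF z \<in> Omega \<times> Omega. K z) \<ge> \<kappa> \<longrightarrow>
       (\<forall>p\<ge>1::real. \<forall>lam>0::real. \<exists>C>0::real. \<forall>n\<ge>1::nat. \<forall>u un.
         minimizer p lam g K u \<longrightarrow> discrete_minimizer p n lam g K un \<longrightarrow>
         (Lnorm (lebesgue_on Omega) 2 (\<lambda>x. inj1 n un x - u x))\<^sup>2
         \<le> ennreal C *
            ((Lnorm (lebesgue_on Omega) 2 (\<lambda>x. g x - inj1 n (proj1 n g) x))\<^sup>2
             + Lnorm (lebesgue_on Omega) 2 (\<lambda>x. g x - inj1 n (proj1 n g) x)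
             + Lnorm (lebesgue_on (Omega \<times> Omega)) \<infinity>
                 (\<lambda>z. K z - inj2 n (proj2 n K) z)
             + ennreal (lam powr (1 / p)) * Lnorm (lebesgue_on Omega) (ennreal p)
                 (\<lambda>x. u x - inj1 n (proj1 n u) x))))"
proof -
  have problem: "nonlocal_problem g K p lam" if "p \<ge> 1" "lam > 0" for p lam
    using that g K_nonneg K_meas K_bdd by (simp add: nonlocal_problem_def)
  have disc: "(Lnorm LI 2 (\<lambda>x. g x - inj1 n (proj1 n g) x))\<^sup>2
      = ennreal (sqnorm (\<lambda>x. g x - inj1 n (proj1 n g) x))" for n
    by (intro Lnorm_sqnorm L2_diff g inj1_in_L2)
  have err: "(Lnorm LI 2 (\<lambda>x. inj1 n un x - u x))\<^sup>2 = ennreal (sqnorm (\<lambda>x. inj1 n un x - u x))"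
    if "u \<in> L2" for n un u
    by (intro Lnorm_sqnorm L2_diff that inj1_in_L2)
  show ?thesis
  proof (intro conjI ballI allI impI)
    fix p :: real
    assume "p \<in> {1..2}"
    then have p12: "1 \<le> p" "p \<le> 2" by auto
    show "\<exists>C>0::real. \<forall>lam>0::real. \<forall>n\<ge>1::nat. \<forall>u un.
        minimizer p lam g K u \<longrightarrow> discrete_minimizer p n lam g K un \<longrightarrow>
        (Lnorm LI 2 (\<lambda>x. inj1 n un x - u x))\<^sup>2
        \<le> ennreal C *
           ((Lnorm LI 2 (\<lambda>x. g x - inj1 n (proj1 n g) x))\<^sup>2
            + Lnorm LI 2 (\<lambda>x. g x - inj1 n (proj1 n g) x)
            + ennreal lam * Lnorm LS (2 / ennreal (2 - p)) (\<lambda>z. K z - inj2 n (proj2 n K) z)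
            + ennreal lam * Lnorm LI (2 / ennreal (3 - p)) (\<lambda>x. u x - inj1 n (proj1 n u) x))"
    proof (intro exI conjI allI impI)
      \<comment> \<open>The constant depends on g alone and is chosen before lam and n.\<close>
      show C: "1 + 16 * sqnorm g > 0" using sqnorm_nonneg[of g] by simp
      fix lam :: real and n :: nat and u un
      assume lam: "lam > 0" and n: "n \<ge> 1"
        and min: "minimizer p lam g K u" and dmin: "discrete_minimizer p n lam g K un"
      interpret nonlocal_problem g K p lam by (rule problem[OF p12(1) lam])
      from error_bound_p_le_2[OF p12(2) n min dmin] obtain e where e: "e \<ge> 0"
        "Lnorm LS (2 / ennreal (2 - p)) (\<lambda>z. K z - inj2 n (proj2 n K) z) = ennreal e"
        "sqnorm (\<lambda>x. inj1 n un x - u x)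
          \<le> (1 + 16 * sqnorm g) * (sqnorm (\<lambda>x. g x - inj1 n (proj1 n g) x) + lam * e)"
        by blast
      have "ennreal lam * ennreal e = ennreal (lam * e)"
        using lam e by (simp add: ennreal_mult)
      then show "(Lnorm LI 2 (\<lambda>x. inj1 n un x - u x))\<^sup>2
        \<le> ennreal (1 + 16 * sqnorm g) *
           ((Lnorm LI 2 (\<lambda>x. g x - inj1 n (proj1 n g) x))\<^sup>2
            + Lnorm LI 2 (\<lambda>x. g x - inj1 n (proj1 n g) x)
            + ennreal lam * Lnorm LS (2 / ennreal (2 - p)) (\<lambda>z. K z - inj2 n (proj2 n K) z)
            + ennreal lam * Lnorm LI (2 / ennreal (3 - p)) (\<lambda>x. u x - inj1 n (proj1 n u) x))"
        unfolding disc err[OF minimizer_D(1)[OF min]] e(2)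
        using ennreal_bound_with_slack[OF e(3) sqnorm_nonneg] lam e(1) C by simp
    qed
  next
    fix \<kappa> p lam :: real
    assume kap: "\<kappa> > 0" and inf: "\<kappa> \<le> (INF z \<in> Omega \<times> Omega. K z)" and p: "1 \<le> p" and lam: "0 < lam"
    \<comment> \<open>A real \<open>INF\<close> is a lower bound for the values only when these are
      bounded below, which \<open>K_bdd\<close> ensures.\<close>
    have K: "\<kappa> \<le> K z" if "z \<in> Omega \<times> Omega" for z
      using inf cINF_lower[OF bounded_imp_bdd_below[OF K_bdd] that] by linarith
    show "\<exists>C>0::real. \<forall>n\<ge>1::nat. \<forall>u un.
        minimizer p lam g K u \<longrightarrow> discrete_minimizer p n lam g K un \<longrightarrow>
        (Lnorm LI 2 (\<lambda>x. inj1 n un x - u x))\<^sup>2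
        \<le> ennreal C *
           ((Lnorm LI 2 (\<lambda>x. g x - inj1 n (proj1 n g) x))\<^sup>2
            + Lnorm LI 2 (\<lambda>x. g x - inj1 n (proj1 n g) x)
            + Lnorm LS \<infinity> (\<lambda>z. K z - inj2 n (proj2 n K) z)
            + ennreal (lam powr (1 / p)) * Lnorm LI (ennreal p) (\<lambda>x. u x - inj1 n (proj1 n u) x))"
    proof (intro exI conjI allI impI)
      show C: "1 + sqnorm g / \<kappa> > 0"
        using kap sqnorm_nonneg[of g] by (simp add: add_pos_nonneg)
      fix n :: nat and u un
      assume n: "n \<ge> 1"
        and min: "minimizer p lam g K u" and dmin: "discrete_minimizer p n lam g K un"
      interpret nonlocal_problem g K p lam by (rule problem[OF p lam])
      from error_bound_coercive[OF kap K n min dmin] obtain e where e: "e \<ge> 0"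
        "Lnorm LS \<infinity> (\<lambda>z. K z - inj2 n (proj2 n K) z) = ennreal e"
        "sqnorm (\<lambda>x. inj1 n un x - u x)
          \<le> (1 + sqnorm g / \<kappa>) * (sqnorm (\<lambda>x. g x - inj1 n (proj1 n g) x) + e)"
        by blast
      show "(Lnorm LI 2 (\<lambda>x. inj1 n un x - u x))\<^sup>2
        \<le> ennreal (1 + sqnorm g / \<kappa>) *
           ((Lnorm LI 2 (\<lambda>x. g x - inj1 n (proj1 n g) x))\<^sup>2
            + Lnorm LI 2 (\<lambda>x. g x - inj1 n (proj1 n g) x)
            + Lnorm LS \<infinity> (\<lambda>z. K z - inj2 n (proj2 n K) z)
            + ennreal (lam powr (1 / p)) * Lnorm LI (ennreal p) (\<lambda>x. u x - inj1 n (proj1 n u) x))"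
        unfolding disc err[OF minimizer_D(1)[OF min]] e(2)
        using ennreal_bound_with_slack[OF e(3) sqnorm_nonneg e(1)] C by simp
    qed
  qed
qed

end
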